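(* For every non-negative integer $k\notin\{1,2,3\}$ there exists a planar cyclically $4$-edge-connected cubic graph with exactly $k$ hamiltonian cycles, while for $k\in\{1,2\}$ there exists no planar cyclically $4$-edge-connected cubic graph with exactly $k$ hamiltonian cycles.
   Context: Graphs are finite and simple; cycles are regarded as subgraphs. A graph is cyclically $4$-edge-connected if there is no set of fewer than $4$ edges whose removal yields a graph with at least two components each containing a cycle. *)

theory Defs
  imports "HOL-Analysis.Analysis"
begin

type_synonym 'a sgraph = "'a set \<times> 'a set set"

abbreviation verts :: "'a sgraph \<Rightarrow> 'a set" where
  "verts G \<equiv> fst G"

abbreviation edges :: "'a sgraph \<Rightarrow> 'a set set" where
  "edges G \<equiv> snd G"

text \<open>Graphs are non-empty, as usual; the null graph would otherwise be a planar cubic graph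
  without hamiltonian cycles.\<close>

definition simple_graph :: "'a sgraph \<Rightarrow> bool" where
  "simple_graph G \<longleftrightarrow> finite (verts G) \<and> verts G \<noteq> {} \<and>
     (\<forall>e\<in>edges G. e \<subseteq> verts G \<and> card e = 2)"

definition subgraph :: "'a sgraph \<Rightarrow> 'a sgraph \<Rightarrow> bool" where
  "subgraph H G \<longleftrightarrow> verts H \<subseteq> verts G \<and> edges H \<subseteq> edges G"

definition cubic :: "'a sgraph \<Rightarrow> bool" where
  "cubic G \<longleftrightarrow> (\<forall>v\<in>verts G. card {e\<in>edges G. v \<in> e} = 3)"

text \<open>A cycle is a graph, not a vertex sequence: all rotations and reversals of \<open>vs\<close> give the
  same cycle, so counting cycles counts subgraphs.\<close>

definition is_cycle :: "'a sgraph \<Rightarrow> bool" where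
  "is_cycle C \<longleftrightarrow> (\<exists>vs. distinct vs \<and> length vs \<ge> 3 \<and>
     C = (set vs, {{vs ! i, vs ! (Suc i mod length vs)} | i. i < length vs}))"

definition contains_cycle :: "'a sgraph \<Rightarrow> bool" where
  "contains_cycle G \<longleftrightarrow> (\<exists>C. is_cycle C \<and> subgraph C G)"

definition hamiltonian_cycles :: "'a sgraph \<Rightarrow> 'a sgraph set" where
  "hamiltonian_cycles G = {C. is_cycle C \<and> subgraph C G \<and> verts C = verts G}"

definition connection_rel :: "'a sgraph \<Rightarrow> ('a \<times> 'a) set" where
  "connection_rel G = {(u, v). {u, v} \<in> edges G}\<^sup>* \<inter> verts G \<times> verts G"

definition graph_components :: "'a sgraph \<Rightarrow> 'a sgraph set" where
  "graph_components G = (\<lambda>W. (W, {e\<in>edges G. e \<subseteq> W})) ` (verts G // connection_rel G)"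

definition delete_edges :: "'a sgraph \<Rightarrow> 'a set set \<Rightarrow> 'a sgraph" where
  "delete_edges G F = (verts G, edges G - F)"

definition cyclically_edge_connected :: "nat \<Rightarrow> 'a sgraph \<Rightarrow> bool" where
  "cyclically_edge_connected n G \<longleftrightarrow>
     \<not> (\<exists>F. F \<subseteq> edges G \<and> finite F \<and> card F < n \<and>
          (\<exists>A\<in>graph_components (delete_edges G F). \<exists>B\<in>graph_components (delete_edges G F).
             A \<noteq> B \<and> contains_cycle A \<and> contains_cycle B))"

text \<open>Topological planarity: vertices are distinct points of the plane, an edge is an arc joining
  its two end vertices, and the interior of an edge meets no vertex and no other edge.\<close>

definition plane_drawing ::
    "'a sgraph \<Rightarrow> ('a \<Rightarrow> complex) \<Rightarrow> ('a set \<Rightarrow> real \<Rightarrow> complex) \<Rightarrow> bool" where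
  "plane_drawing G p \<gamma> \<longleftrightarrow>
     inj_on p (verts G) \<and>
     (\<forall>e\<in>edges G. arc (\<gamma> e) \<and> {pathstart (\<gamma> e), pathfinish (\<gamma> e)} = p ` e) \<and>
     (\<forall>e\<in>edges G. (path_image (\<gamma> e) - p ` e) \<inter> p ` verts G = {}) \<and>
     (\<forall>e\<in>edges G. \<forall>f\<in>edges G. e \<noteq> f \<longrightarrow>
        (path_image (\<gamma> e) - p ` e) \<inter> path_image (\<gamma> f) = {})"

definition planar :: "'a sgraph \<Rightarrow> bool" where
  "planar G \<longleftrightarrow> (\<exists>p \<gamma>. plane_drawing G p \<gamma>)"

end

theory Submission
  imports Defs
begin

text \<open>
  The non-existence half is Smith's theorem on cubic graphs: every edge lies on an even number of
  hamiltonian cycles. A single hamiltonian cycle would contradict this at any of its edges, and two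
  hamiltonian cycles would contradict it at an edge that lies on only one of them. The parity
  follows from counting proper 3-edge-colourings, that is, partitions of the edge set into
  perfect matchings \<open>M\<close>, \<open>N\<close>, \<open>K\<close>. Fix an edge \<open>e\<close> and count the colourings with \<open>e \<in> N\<close>. Their number
  is even because \<open>M\<close> and \<open>K\<close> can be exchanged. Sort them by \<open>M\<close>: if the complement of \<open>M\<close> is a
  hamiltonian cycle through \<open>e\<close>, it splits in exactly one way into \<open>N\<close> and \<open>K\<close>; if it is disconnected,
  exchanging \<open>N\<close> and \<open>K\<close> on a part that avoids \<open>e\<close> shows that it contributes an even number
  (\<open>even_ham_matchings_avoiding_edge\<close>, \<open>not_one_or_two_hamiltonian_cycles\<close>).

  For the existence half, the prism over an \<open>n\<close>-gon with \<open>n \<ge> 4\<close> has \<open>n\<close> hamiltonian cycles if \<open>n\<close> is odd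
  and \<open>n + 2\<close> if \<open>n\<close> is even (\<open>card_hamiltonian_cycles_prism\<close>): one for each position \<open>j\<close>, which uses
  the two rungs at \<open>j\<close> and \<open>j + 1\<close> and misses the two rails between them, and for even \<open>n\<close> two more that
  use all rungs and zigzag between the two \<open>n\<close>-gons. This covers every odd \<open>k \<ge> 5\<close> and every
  even \<open>k \<ge> 6\<close>.

  For \<open>k = 0\<close> and \<open>k = 4\<close> single graphs with 42 and 38 vertices are exhibited. Grinberg's identity shows
  what is special about them: a hamiltonian cycle of a plane graph has the same sum of
  \<open>length F - 2\<close> over the faces \<open>F\<close> on either side. The first graph has one quadrilateral, 18 pentagons
  and 4 octagons, so all summands except one are divisible by 3 and there is no hamiltonian cycle.
  The second one has two quadrilaterals, 16 pentagons, 2 octagons and one decagon. Modulo 3 the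
  identity forces the quadrilaterals and the decagon to lie on the same side of every hamiltonian
  cycle, so there are few of them. The formal proofs do not use faces, however; for each graph they
  check a certificate (\<open>graph_of_certificate\<close>) that consists of three parts.

  \<^item> A sequence of edge insertions that produces the graph from the cube. Subdividing two disjoint
    edges of a cubic graph and joining the two new vertices preserves the property that at
    least four edges leave every vertex set \<open>S\<close> such that \<open>S\<close> and its complement have at least two elements
    (\<open>robust_insert_edge\<close>), and this property implies cyclic 4-edge-connectivity
    (\<open>cyclically_edge_connectedI\<close>).

  \<^item> Integer coordinates of the vertices. That the straight line segments between
    them cross nowhere is a matter of the signs of 2-by-2 determinants
    (\<open>cross_free_segments\<close>, \<open>planar_straight_line\<close>).

  \<^item> An elimination order of the vertices, along which all perfect matchings with connected
    complement are enumerated (\<open>ham_count_correct\<close>).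
\<close>

section \<open>Hamiltonian cycles as complements of perfect matchings\<close>

definition cycle_edge :: "'a list \<Rightarrow> nat \<Rightarrow> 'a set" where
  "cycle_edge vs i = {vs ! i, vs ! (Suc i mod length vs)}"

text \<open>Connectivity is expressed by the absence of a proper non-empty union of components. In
  this form it makes sense for a family of arbitrary sets, that is, for hypergraphs; the
  enumeration of hamiltonian cycles below needs this generality.\<close>

definition connects :: "'a set set \<Rightarrow> 'a set \<Rightarrow> bool" where
  "connects D V \<longleftrightarrow> (\<forall>S. (\<forall>e\<in>D. e \<subseteq> S \<or> e \<inter> S = {}) \<longrightarrow> V \<subseteq> S \<or> V \<inter> S = {})"

definition perfect_matching :: "'a sgraph \<Rightarrow> 'a set set \<Rightarrow> bool" where
  "perfect_matching G M \<longleftrightarrow> M \<subseteq> edges G \<and> (\<forall>v\<in>verts G. \<exists>!e. e \<in> M \<and> v \<in> e)"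

definition ham_matchings :: "'a sgraph \<Rightarrow> 'a set set set" where
  "ham_matchings G = {M. perfect_matching G M \<and> connects (edges G - M) (verts G)}"

lemma is_cycle_iff:
  "is_cycle C \<longleftrightarrow> (\<exists>vs. distinct vs \<and> length vs \<ge> 3 \<and> C = (set vs, cycle_edge vs ` {..<length vs}))"
proof -
  have "{{vs ! i, vs ! (Suc i mod length vs)} | i. i < length vs} = cycle_edge vs ` {..<length vs}" for vs :: "'a list"
    unfolding cycle_edge_def by auto
  then show ?thesis unfolding is_cycle_def by simp
qed

lemma pred_mod:
  assumes "j < (n::nat)"
  shows "(j + n - 1) mod n = (if j = 0 then n - 1 else j - 1)"
proof (cases j)
  case (Suc i)
  then have "j + n - 1 = i + n" by simp
  then show ?thesis using Suc assms by simp
qed (use assms in simp)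

lemma Suc_mod:
  assumes "i < n"
  shows "Suc i mod n = (if Suc i = n then 0 else Suc i)"
  using assms by auto

lemma nth_in_cycle_edge_iff:
  assumes d: "distinct vs" and i: "i < length vs" and j: "j < length vs"
  shows "vs ! j \<in> cycle_edge vs i \<longleftrightarrow> i = j \<or> i = (j + length vs - 1) mod length vs"
proof -
  let ?n = "length vs"
  have eq: "vs ! a = vs ! b \<longleftrightarrow> a = b" if "a < ?n" "b < ?n" for a b
    using d that by (simp add: nth_eq_iff_index_eq)
  have "Suc i mod ?n < ?n" using i by (intro mod_less_divisor) linarith
  then have "vs ! j \<in> cycle_edge vs i \<longleftrightarrow> j = i \<or> j = Suc i mod ?n"
    using eq[OF j i] eq[OF j] by (simp add: cycle_edge_def)
  also have "\<dots> \<longleftrightarrow> i = j \<or> i = (j + ?n - 1) mod ?n"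
    unfolding pred_mod[OF j] Suc_mod[OF i] using i j by auto
  finally show ?thesis .
qed

lemma cycle_edges_at:
  assumes d: "distinct vs" and len: "length vs \<ge> 3" and j: "j < length vs"
  shows "{e \<in> cycle_edge vs ` {..<length vs}. vs ! j \<in> e} =
           {cycle_edge vs j, cycle_edge vs ((j + length vs - 1) mod length vs)}"
    and "cycle_edge vs j \<noteq> cycle_edge vs ((j + length vs - 1) mod length vs)"
proof -
  let ?n = "length vs"
  let ?p = "(j + ?n - 1) mod ?n"
  have p: "?p < ?n" using j by (intro mod_less_divisor) linarith
  show "{e \<in> cycle_edge vs ` {..<?n}. vs ! j \<in> e} = {cycle_edge vs j, cycle_edge vs ?p}"
    using nth_in_cycle_edge_iff[OF d _ j] j p by auto
  have "j \<noteq> ?p" "j \<noteq> (?p + ?n - 1) mod ?n"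
    unfolding pred_mod[OF p] unfolding pred_mod[OF j] using len j by (auto split: if_splits)
  then have "vs ! ?p \<notin> cycle_edge vs j"
    using nth_in_cycle_edge_iff[OF d j p] by blast
  moreover have "vs ! ?p \<in> cycle_edge vs ?p" by (simp add: cycle_edge_def)
  ultimately show "cycle_edge vs j \<noteq> cycle_edge vs ?p" by metis
qed

lemma cycle_degree:
  assumes "distinct vs" "length vs \<ge> 3" "v \<in> set vs"
  shows "card {e \<in> cycle_edge vs ` {..<length vs}. v \<in> e} = 2"
proof -
  obtain j where j: "j < length vs" "v = vs ! j" using assms(3) by (auto simp: in_set_conv_nth)
  show ?thesis using cycle_edges_at[OF assms(1,2) j(1)] j(2) by simp
qed

lemma cycle_connects: "connects (cycle_edge vs ` {..<length vs}) (set vs)"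
  unfolding connects_def
proof (intro allI impI)
  fix S assume cl: "\<forall>e\<in>cycle_edge vs ` {..<length vs}. e \<subseteq> S \<or> e \<inter> S = {}"
  have "vs ! i \<in> S \<longleftrightarrow> vs ! 0 \<in> S" if "i < length vs" for i
    using that
  proof (induction i)
    case (Suc i)
    then have "cycle_edge vs i \<subseteq> S \<or> cycle_edge vs i \<inter> S = {}" using cl by simp
    then have "vs ! Suc i \<in> S \<longleftrightarrow> vs ! i \<in> S" using Suc.prems by (auto simp: cycle_edge_def)
    with Suc show ?case by simp
  qed simp
  then show "set vs \<subseteq> S \<or> set vs \<inter> S = {}" by (auto simp: in_set_conv_nth subset_iff)
qed

text \<open>A longest path must close up: both neighbours of its last vertex lie on the path, and an
  inner vertex of the path cannot have the last vertex as a third neighbour. The closed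
  path is a component, hence everything.\<close>

lemma connected_two_regular_is_cycle:
  assumes fin: "finite V" and ne: "V \<noteq> {}"
    and D: "\<And>e. e \<in> D \<Longrightarrow> e \<subseteq> V \<and> card e = 2"
    and deg: "\<And>v. v \<in> V \<Longrightarrow> card {e \<in> D. v \<in> e} = 2"
    and con: "connects D V"
  shows "is_cycle (V, D)"
proof -
  define P where "P vs \<longleftrightarrow> distinct vs \<and> vs \<noteq> [] \<and> set vs \<subseteq> V \<and>
      (\<forall>i. Suc i < length vs \<longrightarrow> {vs ! i, vs ! Suc i} \<in> D)" for vs
  obtain v0 where "v0 \<in> V" using ne by blast
  then have "P [v0]" by (simp add: P_def)
  moreover have "\<forall>vs. P vs \<longrightarrow> length vs < Suc (card V)"
    using fin by (metis P_def card_mono distinct_card le_imp_less_Suc)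
  ultimately have "\<exists>vs. P vs \<and> (\<forall>ws. P ws \<longrightarrow> length ws \<le> length vs)"
    by (rule ex_has_greatest_nat[where f = length])
  then obtain vs where P: "P vs" and max: "\<And>ws. P ws \<Longrightarrow> length ws \<le> length vs"
    by blast
  define n where "n = length vs"
  define x where "x = vs ! (n - 1)"
  have d: "distinct vs" and n0: "n > 0" and sub: "set vs \<subseteq> V"
    and step: "\<And>i. Suc i < n \<Longrightarrow> {vs ! i, vs ! Suc i} \<in> D"
    using P by (auto simp: P_def n_def)
  have eq: "vs ! a = vs ! b \<longleftrightarrow> a = b" if "a < n" "b < n" for a b
    using d that by (simp add: nth_eq_iff_index_eq n_def)
  have xV: "x \<in> V" using n0 sub by (auto simp: x_def n_def subset_iff)
  have at_x: "\<exists>i. Suc i < n \<and> e = {x, vs ! i}" if e: "e \<in> D" "x \<in> e" for e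
  proof -
    have "card e = 2" using D e(1) by blast
    then obtain y where y: "e = {x, y}" "y \<noteq> x" using e(2) by (auto simp: card_2_iff)
    have yV: "y \<in> V" using D e(1) y(1) by auto
    have "y \<in> set vs"
    proof (rule ccontr)
      assume ny: "y \<notin> set vs"
      have "{(vs @ [y]) ! i, (vs @ [y]) ! Suc i} \<in> D" if "Suc i < length (vs @ [y])" for i
      proof (cases "Suc i < n")
        case True then show ?thesis using step by (simp add: nth_append n_def)
      next
        case False
        then have "i = n - 1" using that n0 by (simp add: n_def)
        then show ?thesis using e(1) y(1) n0 by (simp add: nth_append n_def x_def)
      qed
      then have "P (vs @ [y])" using d ny sub yV by (simp add: P_def)
      from max[OF this] show False by simp
    qed
    then obtain i where i: "i < n" "y = vs ! i" by (auto simp: in_set_conv_nth n_def)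
    moreover have "i \<noteq> n - 1" using y(2) i(2) by (auto simp: x_def)
    ultimately show ?thesis using y(1) by (intro exI[of _ i]) auto
  qed
  obtain e1 e2 where e12: "{e \<in> D. x \<in> e} = {e1, e2}" "e1 \<noteq> e2"
    using deg[OF xV] by (auto simp: card_2_iff)
  then obtain i1 i2 where "Suc i1 < n" "e1 = {x, vs ! i1}" "Suc i2 < n" "e2 = {x, vs ! i2}"
    using at_x by (metis (no_types, lifting) insert_iff mem_Collect_eq)
  then obtain i j where ij: "i < j" "Suc j < n" "{x, vs ! i} \<in> D"
    using e12 by (metis (no_types, lifting) insert_iff linorder_neqE_nat mem_Collect_eq)
  have "i = 0"
  proof (rule ccontr)
    assume i: "i \<noteq> 0"
    \<comment> \<open>The vertex at position \<open>i\<close> would have three neighbours.\<close>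
    let ?T = "{{vs ! (i - 1), vs ! i}, {vs ! i, vs ! Suc i}, {x, vs ! i}}"
    have T: "?T \<subseteq> {e \<in> D. vs ! i \<in> e}" using step[of "i - 1"] step[of i] i ij by auto
    have "card ?T = 3" using i ij eq[of "i - 1" "Suc i"] eq[of "i - 1" "n - 1"] eq[of "Suc i" "n - 1"]
        eq[of i "n - 1"] eq[of i "Suc i"] eq[of i "i - 1"]
      by (auto simp: x_def doubleton_eq_iff card_insert_if)
    moreover have "vs ! i \<in> V" using sub ij by (auto simp: n_def subset_iff)
    from deg[OF this] have "card {e \<in> D. vs ! i \<in> e} = 2" "finite {e \<in> D. vs ! i \<in> e}"
      by (simp, intro card_ge_0_finite, simp)
    ultimately show False using T card_mono[of "{e \<in> D. vs ! i \<in> e}" ?T] by linarith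
  qed
  then have n3: "n \<ge> 3" and closing: "{x, vs ! 0} \<in> D" using ij by auto
  let ?C = "cycle_edge vs ` {..<n}"
  have CD: "?C \<subseteq> D"
  proof
    fix e assume "e \<in> ?C"
    then obtain k where k: "k < n" "e = cycle_edge vs k" by auto
    show "e \<in> D"
    proof (cases "Suc k = n")
      case True
      then have "e = {vs ! (n - 1), vs ! 0}" using k by (auto simp: cycle_edge_def n_def[symmetric])
      then show ?thesis using closing by (simp add: x_def)
    next
      case False
      then have "Suc k < n" using k by simp
      then show ?thesis using k step[of k] by (simp add: cycle_edge_def n_def[symmetric])
    qed
  qed
  have at: "{e \<in> D. v \<in> e} = {e \<in> ?C. v \<in> e}" if v: "v \<in> set vs" for v
  proof (rule sym, rule card_subset_eq)
    have 2: "card {e \<in> D. v \<in> e} = 2" using deg v sub by blast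
    then show "finite {e \<in> D. v \<in> e}" by (intro card_ge_0_finite) simp
    show "card {e \<in> ?C. v \<in> e} = card {e \<in> D. v \<in> e}"
      using cycle_degree[OF d _ v] n3 2 by (simp add: n_def)
    show "{e \<in> ?C. v \<in> e} \<subseteq> {e \<in> D. v \<in> e}" using CD by blast
  qed
  have Csub: "e \<subseteq> set vs" if "e \<in> ?C" for e
    using that n0 by (auto simp: cycle_edge_def n_def)
  have "e \<subseteq> set vs \<or> e \<inter> set vs = {}" if "e \<in> D" for e
    using at Csub that by blast
  then have "V \<subseteq> set vs \<or> V \<inter> set vs = {}" using con unfolding connects_def by blast
  moreover have "set vs \<noteq> {}" using n0 by (simp add: n_def)
  then have "V \<inter> set vs \<noteq> {}" using sub by (simp add: Int_absorb1)
  ultimately have "V \<subseteq> set vs" by simp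
  then have V: "V = set vs" using sub by simp
  have "D \<subseteq> ?C"
  proof
    fix e assume e: "e \<in> D"
    then have "e \<noteq> {}" "e \<subseteq> V" using D by force+
    then obtain v where "v \<in> e" "v \<in> set vs" using V by blast
    then show "e \<in> ?C" using at e by blast
  qed
  then show ?thesis using CD V d n3 unfolding is_cycle_iff n_def by blast
qed

lemma bij_ham_matchings_cycles:
  assumes simple: "simple_graph G" and cubic: "cubic G"
  shows "bij_betw (\<lambda>M. (verts G, edges G - M)) (ham_matchings G) (hamiltonian_cycles G)"
proof -
  have fin: "finite (verts G)" and ne: "verts G \<noteq> {}"
    and E: "\<And>e. e \<in> edges G \<Longrightarrow> e \<subseteq> verts G \<and> card e = 2"
    using simple by (auto simp: simple_graph_def)
  have deg3: "card {e \<in> edges G. v \<in> e} = 3" if "v \<in> verts G" for v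
    using cubic that by (simp add: cubic_def)
  have to: "(verts G, edges G - M) \<in> hamiltonian_cycles G" if M: "M \<in> ham_matchings G" for M
  proof -
    have "is_cycle (verts G, edges G - M)"
    proof (rule connected_two_regular_is_cycle[OF fin ne])
      fix v assume v: "v \<in> verts G"
      then have "\<exists>!e. e \<in> M \<and> v \<in> e" using M by (simp add: ham_matchings_def perfect_matching_def)
      then obtain e where e: "e \<in> M" "v \<in> e" "\<forall>f. f \<in> M \<and> v \<in> f \<longrightarrow> f = e"
        by (rule ex1E) blast
      then have "{f \<in> edges G - M. v \<in> f} = {f \<in> edges G. v \<in> f} - {e}" by blast
      moreover have "M \<subseteq> edges G" using M by (simp add: ham_matchings_def perfect_matching_def)
      then have "e \<in> {f \<in> edges G. v \<in> f}" using e(1,2) by blast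
      ultimately show "card {f \<in> edges G - M. v \<in> f} = 2" using deg3[OF v] by simp
    qed (use E M in \<open>auto simp: ham_matchings_def\<close>)
    then show ?thesis by (auto simp: hamiltonian_cycles_def subgraph_def)
  qed
  have "inj_on (\<lambda>M. (verts G, edges G - M)) (ham_matchings G)"
    by (rule inj_onI) (auto simp: ham_matchings_def perfect_matching_def)
  moreover have onto: "C \<in> (\<lambda>M. (verts G, edges G - M)) ` ham_matchings G" if C: "C \<in> hamiltonian_cycles G" for C
  proof
    obtain vs where vs: "distinct vs" "length vs \<ge> 3" "C = (set vs, cycle_edge vs ` {..<length vs})"
      using C by (auto simp: hamiltonian_cycles_def is_cycle_iff)
    have V: "verts G = set vs" and D: "edges C \<subseteq> edges G"
      using C vs(3) by (auto simp: hamiltonian_cycles_def subgraph_def)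
    let ?M = "edges G - edges C"
    have GM: "edges G - ?M = edges C" using D by blast
    show "C = (verts G, edges G - ?M)" unfolding GM V using vs(3) by simp
    have "\<exists>!e. e \<in> ?M \<and> v \<in> e" if v: "v \<in> verts G" for v
    proof -
      have f: "finite {e \<in> edges G. v \<in> e}" using deg3[OF v] by (intro card_ge_0_finite) simp
      have "card {e \<in> edges C. v \<in> e} = 2" using cycle_degree[OF vs(1,2)] v V vs(3) by simp
      moreover have sub: "{e \<in> edges C. v \<in> e} \<subseteq> {e \<in> edges G. v \<in> e}" using D by blast
      moreover have "{e \<in> ?M. v \<in> e} = {e \<in> edges G. v \<in> e} - {e \<in> edges C. v \<in> e}" by blast
      ultimately have "card {e \<in> ?M. v \<in> e} = 1"
        using deg3[OF v] card_Diff_subset[OF finite_subset[OF sub f] sub] by simp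
      then obtain e where "{e \<in> ?M. v \<in> e} = {e}" by (auto simp: card_1_singleton_iff)
      then have "f \<in> ?M \<and> v \<in> f \<longleftrightarrow> f = e" for f by blast
      then show ?thesis by simp
    qed
    then have "perfect_matching G ?M" by (simp add: perfect_matching_def)
    moreover have "connects (edges G - ?M) (verts G)"
      unfolding GM V using vs(3) cycle_connects[of vs] by simp
    ultimately show "?M \<in> ham_matchings G" unfolding ham_matchings_def by blast
  qed
  ultimately show ?thesis using to by (intro bij_betw_imageI equalityI subsetI) (auto simp only: image_iff)
qed

text \<open>In a cubic graph the complement of a perfect matching is 2-regular, so it is a
  hamiltonian cycle as soon as it is connected.\<close>

lemma card_hamiltonian_cycles:
  assumes "simple_graph G" "cubic G"
  shows "card (hamiltonian_cycles G) = card (ham_matchings G)"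
  using bij_betw_same_card[OF bij_ham_matchings_cycles[OF assms]] by simp

section \<open>Parity of the number of hamiltonian cycles\<close>

lemma even_card_involution:
  assumes "finite A" and "\<And>x. x \<in> A \<Longrightarrow> f x \<in> A \<and> f x \<noteq> x \<and> f (f x) = x"
  shows "even (card A)"
  using assms
proof (induction "card A" arbitrary: A rule: less_induct)
  case less
  show ?case
  proof (cases "A = {}")
    case False
    then obtain a where a: "a \<in> A" by blast
    let ?B = "A - {a, f a}"
    have c: "card {a, f a} = 2" using less.prems(2)[OF a] by (simp add: card_2_iff) metis
    have sub: "{a, f a} \<subseteq> A" using less.prems(2)[OF a] a by blast
    have B: "card ?B = card A - 2" using less.prems(1) sub c by (simp only: card_Diff_subset finite.intros)
    have "card {a, f a} \<le> card A" using less.prems(1) sub by (rule card_mono)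
    then have A: "card A = card ?B + 2" using B c by linarith
    have inv: "f x \<in> ?B \<and> f x \<noteq> x \<and> f (f x) = x" if "x \<in> ?B" for x
      using less.prems(2)[of x] less.prems(2)[OF a] that by (metis DiffD1 DiffD2 DiffI insert_iff singletonD)
    have "even (card ?B)"
      by (rule less.hyps) (use A less.prems(1) inv in auto)
    then show ?thesis using A by simp
  qed simp
qed

lemma perfect_matching_at:
  assumes "perfect_matching G M" "v \<in> verts G"
  obtains m where "m \<in> M" "v \<in> m" "\<forall>f\<in>M. v \<in> f \<longrightarrow> f = m"
proof -
  have "\<exists>!e. e \<in> M \<and> v \<in> e" using assms by (simp add: perfect_matching_def)
  then show ?thesis using that by (metis (no_types, lifting))
qed

lemma perfect_matchingI:
  assumes "M \<subseteq> edges G"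
    and "\<And>v. v \<in> verts G \<Longrightarrow> \<exists>m. m \<in> M \<and> v \<in> m \<and> (\<forall>f. f \<in> M \<and> v \<in> f \<longrightarrow> f = m)"
  shows "perfect_matching G M"
  unfolding perfect_matching_def Ex1_def using assms by (simp add: conj_assoc)

text \<open>The edges outside two disjoint perfect matchings of a cubic graph are the third colour
  class of a 3-edge-colouring.\<close>

lemma perfect_matching_third:
  assumes cubic: "cubic G" and M: "perfect_matching G M" and N: "perfect_matching G N"
    and disj: "N \<inter> M = {}"
  shows "perfect_matching G (edges G - N - M)"
proof (rule perfect_matchingI)
  fix v assume v: "v \<in> verts G"
  obtain m where m: "m \<in> M" "v \<in> m" "\<forall>f\<in>M. v \<in> f \<longrightarrow> f = m"
    by (rule perfect_matching_at[OF M v])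
  obtain n where n: "n \<in> N" "v \<in> n" "\<forall>f\<in>N. v \<in> f \<longrightarrow> f = n"
    by (rule perfect_matching_at[OF N v])
  have sub: "M \<subseteq> edges G" "N \<subseteq> edges G" using M N by (simp_all add: perfect_matching_def)
  have "{f \<in> edges G - N - M. v \<in> f} = {f \<in> edges G. v \<in> f} - {m, n}" using m n by blast
  moreover have "{m, n} \<subseteq> {f \<in> edges G. v \<in> f}" using m n sub by blast
  moreover have "m \<noteq> n" using m n disj by blast
  moreover have "card {f \<in> edges G. v \<in> f} = 3" using cubic v by (simp add: cubic_def)
  ultimately have "card {f \<in> edges G - N - M. v \<in> f} = 1"
    by (simp add: card_Diff_subset)
  then obtain k where "{f \<in> edges G - N - M. v \<in> f} = {k}" by (auto simp: card_1_singleton_iff)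
  then have "f \<in> edges G - N - M \<and> v \<in> f \<longleftrightarrow> f = k" for f by blast
  then show "\<exists>m. m \<in> edges G - N - M \<and> v \<in> m \<and> (\<forall>f. f \<in> edges G - N - M \<and> v \<in> f \<longrightarrow> f = m)"
    by simp
qed blast

text \<open>The edges of a perfect matching partition the vertices into pairs.\<close>

lemma even_card_verts:
  assumes simple: "simple_graph G" and M: "perfect_matching G M"
  shows "even (card (verts G))"
proof -
  have E: "\<And>e. e \<in> M \<Longrightarrow> e \<subseteq> verts G \<and> card e = 2" and fin: "finite (verts G)"
    using simple M by (auto simp: simple_graph_def perfect_matching_def)
  have "\<Union>M = verts G"
  proof
    show "verts G \<subseteq> \<Union>M" using perfect_matching_at[OF M] by (metis UnionI subsetI)
  qed (use E in blast)
  moreover have "card (\<Union>M) = (\<Sum>e\<in>M. card e)"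
  proof (rule card_Union_disjoint)
    show "pairwise disjnt M"
    proof (rule pairwiseI)
      fix e f assume ef: "e \<in> M" "f \<in> M" "e \<noteq> f"
      have False if "v \<in> e" "v \<in> f" for v
      proof -
        have "v \<in> verts G" using E ef that by blast
        then show False using perfect_matching_at[OF M] ef that by metis
      qed
      then show "disjnt e f" by (auto simp: disjnt_def)
    qed
    show "\<And>e. e \<in> M \<Longrightarrow> finite e" using E fin finite_subset by blast
  qed
  moreover have "(\<Sum>e\<in>M. card e) = 2 * card M" using E by simp
  ultimately show ?thesis by simp
qed

text \<open>The hamiltonian cycle has even length, so its edges can be coloured alternately; the
  class that contains \<open>e\<close> is the required matching.\<close>

lemma colouring_of_hamiltonian_matching:
  assumes simple: "simple_graph G" and cubic: "cubic G"
    and M: "M \<in> ham_matchings G" and e: "e \<in> edges G" "e \<notin> M"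
  shows "\<exists>N. perfect_matching G N \<and> N \<inter> M = {} \<and> e \<in> N"
proof -
  have pm: "perfect_matching G M" using M by (simp add: ham_matchings_def)
  have "(verts G, edges G - M) \<in> hamiltonian_cycles G"
    using bij_betw_apply[OF bij_ham_matchings_cycles[OF simple cubic] M] .
  then obtain vs where d: "distinct vs" and len: "length vs \<ge> 3"
    and V: "verts G = set vs" and D: "edges G - M = cycle_edge vs ` {..<length vs}"
    unfolding hamiltonian_cycles_def is_cycle_iff by auto
  let ?n = "length vs"
  have ev: "even ?n" using even_card_verts[OF simple pm] V d by (simp add: distinct_card)
  obtain i0 where i0: "i0 < ?n" "e = cycle_edge vs i0" using e D by blast
  define N where "N = cycle_edge vs ` {i. i < ?n \<and> even i = even i0}"
  have "N \<subseteq> edges G - M" unfolding D N_def by blast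
  moreover have "perfect_matching G N"
  proof (rule perfect_matchingI)
    show "N \<subseteq> edges G" using \<open>N \<subseteq> edges G - M\<close> by blast
    fix v assume "v \<in> verts G"
    then obtain j where j: "j < ?n" "v = vs ! j" using V by (auto simp: in_set_conv_nth)
    let ?p = "(j + ?n - 1) mod ?n"
    have p: "?p < ?n" using j by (intro mod_less_divisor) linarith
    have par: "even ?p \<longleftrightarrow> odd j" unfolding pred_mod[OF j(1)] using ev len by auto
    define k where "k = (if even j = even i0 then j else ?p)"
    have k: "k < ?n" "even k = even i0" "v \<in> cycle_edge vs k"
      using j p par nth_in_cycle_edge_iff[OF d _ j(1)] by (auto simp: k_def)
    have "f = cycle_edge vs k" if f: "f \<in> N" "v \<in> f" for f
    proof -
      obtain i where i: "i < ?n" "even i = even i0" "f = cycle_edge vs i" using f by (auto simp: N_def)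
      then have "i = j \<or> i = ?p" using nth_in_cycle_edge_iff[OF d i(1) j(1)] f j by simp
      then have "i = k" using i(2) par by (auto simp: k_def)
      then show ?thesis using i by simp
    qed
    then show "\<exists>m. m \<in> N \<and> v \<in> m \<and> (\<forall>f. f \<in> N \<and> v \<in> f \<longrightarrow> f = m)"
      using k by (intro exI[of _ "cycle_edge vs k"]) (auto simp: N_def)
  qed
  moreover have "e \<in> N" using i0 by (auto simp: N_def)
  ultimately show ?thesis by blast
qed

text \<open>The hamiltonian cycle has even length, so its edges can be coloured alternately; the
  class that contains \<open>e\<close> is the required matching.\<close>

text \<open>The vertices at which two such colourings agree are closed under the edges of the
  hamiltonian cycle, and the ends of \<open>e\<close> are among them.\<close>

lemma colouring_of_hamiltonian_matching_unique:
  assumes simple: "simple_graph G" and cubic: "cubic G"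
    and M: "M \<in> ham_matchings G" and e: "e \<in> edges G"
    and N: "perfect_matching G N" "N \<inter> M = {}" "e \<in> N"
    and N': "perfect_matching G N'" "N' \<inter> M = {}" "e \<in> N'"
  shows "N \<subseteq> N'"
proof -
  have E: "\<And>e. e \<in> edges G \<Longrightarrow> e \<subseteq> verts G \<and> card e = 2"
    using simple by (auto simp: simple_graph_def)
  have pm: "perfect_matching G M" and con: "connects (edges G - M) (verts G)"
    using M by (simp_all add: ham_matchings_def)
  have sub: "N \<subseteq> edges G" "N' \<subseteq> edges G" using N N' by (simp_all add: perfect_matching_def)
  \<comment> \<open>The vertices at which the two colourings agree.\<close>
  define S where "S = {v \<in> verts G. \<exists>f\<in>N \<inter> N'. v \<in> f}"
  have K: "perfect_matching G (edges G - N - M)" using perfect_matching_third[OF cubic pm N(1,2)] .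
  have "f \<subseteq> S" if f: "f \<in> edges G - M" and v: "v \<in> f" "v \<in> S" for f v
  proof (cases "f \<in> N \<inter> N'")
    case True
    then show ?thesis using E sub by (auto simp: S_def)
  next
    case False
    obtain g where g: "g \<in> N" "g \<in> N'" "v \<in> g" "v \<in> verts G" using v by (auto simp: S_def)
    have nf: "f \<notin> N" "f \<notin> N'"
      using False g v perfect_matching_at[OF N(1) g(4)] perfect_matching_at[OF N'(1) g(4)] by (metis IntI)+
    show ?thesis
    proof
      fix w assume w: "w \<in> f"
      then have wV: "w \<in> verts G" using E f by blast
      obtain h where h: "h \<in> N'" "w \<in> h" using perfect_matching_at[OF N'(1) wV] by metis
      have "h \<in> N"
      proof (rule ccontr)
        assume "h \<notin> N"
        then have "h \<in> edges G - N - M" "f \<in> edges G - N - M" using h sub N' f nf by auto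
        then have "h = f" using perfect_matching_at[OF K wV] h w by metis
        then show False using h nf by simp
      qed
      then show "w \<in> S" using h wV by (auto simp: S_def)
    qed
  qed
  then have "\<forall>f\<in>edges G - M. f \<subseteq> S \<or> f \<inter> S = {}" by blast
  then have "verts G \<subseteq> S \<or> verts G \<inter> S = {}" using con unfolding connects_def by blast
  moreover have "e \<noteq> {}" "e \<subseteq> S" using E[OF e] N N' by (auto simp: S_def)
  ultimately have VS: "verts G \<subseteq> S" using E[OF e] by blast
  show ?thesis
  proof
    fix f assume f: "f \<in> N"
    then have "f \<noteq> {}" "f \<subseteq> verts G" using E sub by force+
    then obtain v where v: "v \<in> f" "v \<in> verts G" by blast
    then obtain g where "g \<in> N" "g \<in> N'" "v \<in> g" using VS by (auto simp: S_def)
    then show "f \<in> N'" using perfect_matching_at[OF N(1) v(2)] f v by metis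
  qed
qed

text \<open>Exchanging the two colours other than \<open>M\<close> on a union of components of the
  complement of \<open>M\<close> that avoids \<open>e\<close> is an involution without fixed
  points.\<close>

lemma even_colourings_of_disconnected_matching:
  assumes simple: "simple_graph G" and cubic: "cubic G"
    and M: "perfect_matching G M" and ncon: "\<not> connects (edges G - M) (verts G)"
    and e: "e \<in> edges G" "e \<notin> M"
  shows "even (card {N. perfect_matching G N \<and> N \<inter> M = {} \<and> e \<in> N})"
proof -
  have E: "\<And>e. e \<in> edges G \<Longrightarrow> e \<subseteq> verts G \<and> card e = 2" and fin: "finite (verts G)"
    using simple by (auto simp: simple_graph_def)
  have finE: "finite (edges G)" using E fin by (intro finite_subset[of "edges G" "Pow (verts G)"]) auto
  obtain S' where S': "\<And>f. f \<in> edges G - M \<Longrightarrow> f \<subseteq> S' \<or> f \<inter> S' = {}"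
    "\<not> verts G \<subseteq> S'" "verts G \<inter> S' \<noteq> {}"
    using ncon unfolding connects_def by blast
  define S where "S = (if e \<subseteq> S' then verts G - S' else S')"
  have closed: "f \<subseteq> S \<or> f \<inter> S = {}" if "f \<in> edges G - M" for f
    using S'(1)[OF that] E that by (auto simp: S_def)
  have eS: "e \<inter> S = {}" using S'(1)[of e] e by (auto simp: S_def)
  have "S \<inter> verts G \<noteq> {}" using S'(2,3) by (auto simp: S_def)
  then obtain v0 where v0: "v0 \<in> S" "v0 \<in> verts G" by blast
  \<comment> \<open>Exchange of the colours inside \<open>S\<close>.\<close>
  define sw where "sw N = {f \<in> N. \<not> f \<subseteq> S} \<union> {f \<in> edges G - N - M. f \<subseteq> S}" for N
  let ?X = "{N. perfect_matching G N \<and> N \<inter> M = {} \<and> e \<in> N}"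
  show ?thesis
  proof (rule even_card_involution[where f = sw])
    show "finite ?X"
      by (rule finite_subset[of _ "Pow (edges G)"]) (use finE in \<open>auto simp: perfect_matching_def\<close>)
    fix N assume "N \<in> ?X"
    then have N: "perfect_matching G N" "N \<inter> M = {}" "e \<in> N" by auto
    have NE: "N \<subseteq> edges G" "M \<subseteq> edges G" using N M by (simp_all add: perfect_matching_def)
    have K: "perfect_matching G (edges G - N - M)" using perfect_matching_third[OF cubic M N(1,2)] .
    have "perfect_matching G (sw N)"
    proof (rule perfect_matchingI)
      fix v assume v: "v \<in> verts G"
      obtain n where n: "n \<in> N" "v \<in> n" "\<forall>f\<in>N. v \<in> f \<longrightarrow> f = n"
        by (rule perfect_matching_at[OF N(1) v])
      obtain k where k: "k \<in> edges G - N - M" "v \<in> k" "\<forall>f\<in>edges G - N - M. v \<in> f \<longrightarrow> f = k"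
        by (rule perfect_matching_at[OF K v])
      have inS: "f \<subseteq> S \<longleftrightarrow> v \<in> S" if "f \<in> edges G - M" "v \<in> f" for f
        using closed[OF that(1)] that(2) by blast
      have kn: "n \<in> edges G - M" "k \<in> edges G - M" using n(1) k(1) N(2) NE by blast+
      have "f \<in> sw N \<and> v \<in> f \<longleftrightarrow> f = (if v \<in> S then k else n)" for f
      proof
        assume f: "f \<in> sw N \<and> v \<in> f"
        then have "f \<in> edges G - M" using N NE by (auto simp: sw_def)
        then show "f = (if v \<in> S then k else n)"
          using f inS[of f] n(3) k(3) unfolding sw_def by (simp split: if_split) blast
      next
        assume "f = (if v \<in> S then k else n)"
        then show "f \<in> sw N \<and> v \<in> f"
          using n(1,2) k(1,2) inS[OF kn(1) n(2)] inS[OF kn(2) k(2)] by (simp add: sw_def)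
      qed
      then show "\<exists>m. m \<in> sw N \<and> v \<in> m \<and> (\<forall>f. f \<in> sw N \<and> v \<in> f \<longrightarrow> f = m)" by simp
    qed (use NE in \<open>auto simp: sw_def\<close>)
    moreover have "sw N \<inter> M = {}" using N(2) by (auto simp: sw_def)
    moreover have "e \<in> sw N"
    proof -
      have "e \<noteq> {}" using E[OF e(1)] by auto
      then show ?thesis using eS N(3) by (auto simp: sw_def)
    qed
    moreover have "sw N \<noteq> N"
    proof -
      obtain n where n: "n \<in> N" "v0 \<in> n" using perfect_matching_at[OF N(1) v0(2)] by metis
      then have "n \<subseteq> S" using closed[of n] NE N(2) v0 by blast
      then show ?thesis using n by (auto simp: sw_def)
    qed
    moreover have "sw (sw N) = N" using NE N(2) by (auto simp: sw_def)
    ultimately show "sw N \<in> ?X \<and> sw N \<noteq> N \<and> sw (sw N) = N" by blast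
  qed
qed

text \<open>Smith's theorem: the hamiltonian cycles through \<open>e\<close> are the complements of
  the matchings in question. Both sides of the double count concern pairs of disjoint
  perfect matchings \<open>M\<close> and \<open>N\<close> with \<open>e \<in> N\<close>.\<close>

lemma even_ham_matchings_avoiding_edge:
  assumes simple: "simple_graph G" and cubic: "cubic G" and e: "e \<in> edges G"
  shows "even (card {M \<in> ham_matchings G. e \<notin> M})"
proof -
  have E: "\<And>e. e \<in> edges G \<Longrightarrow> e \<subseteq> verts G \<and> card e = 2" and fin: "finite (verts G)"
    and ne: "verts G \<noteq> {}"
    using simple by (auto simp: simple_graph_def)
  have finE: "finite (edges G)" using E fin by (intro finite_subset[of "edges G" "Pow (verts G)"]) auto
  define PM where "PM = {M. perfect_matching G M}"
  define F where "F M = {N. perfect_matching G N \<and> N \<inter> M = {} \<and> e \<in> N}" for M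
  have finPM: "finite PM"
    by (rule finite_subset[of _ "Pow (edges G)"]) (use finE in \<open>auto simp: PM_def perfect_matching_def\<close>)
  have finF: "finite (F M)" for M
    by (rule finite_subset[OF _ finPM]) (auto simp: F_def PM_def)
  have "even (card (Sigma PM F))"
  proof (rule even_card_involution[where f = "\<lambda>(M, N). (edges G - N - M, N)"])
    show "finite (Sigma PM F)" using finPM finF by (intro finite_SigmaI) auto
    fix x assume "x \<in> Sigma PM F"
    then obtain M N where x: "x = (M, N)" and M: "perfect_matching G M"
      and N: "perfect_matching G N" "N \<inter> M = {}" "e \<in> N"
      by (auto simp: PM_def F_def)
    have sub: "M \<subseteq> edges G" "N \<subseteq> edges G" using M N by (simp_all add: perfect_matching_def)
    have "edges G - N - M \<noteq> M"
    proof -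
      obtain v where "v \<in> verts G" using ne by blast
      then obtain m where "m \<in> M" using perfect_matching_at[OF M] by metis
      then show ?thesis by blast
    qed
    moreover have "edges G - N - (edges G - N - M) = M" using sub N(2) by blast
    moreover have "edges G - N - M \<in> PM" using perfect_matching_third[OF cubic M N(1,2)] by (simp add: PM_def)
    moreover have "N \<in> F (edges G - N - M)" using N by (auto simp: F_def)
    ultimately show "(case x of (M, N) \<Rightarrow> (edges G - N - M, N)) \<in> Sigma PM F \<and>
        (case x of (M, N) \<Rightarrow> (edges G - N - M, N)) \<noteq> x \<and>
        (case case x of (M, N) \<Rightarrow> (edges G - N - M, N) of (M, N) \<Rightarrow> (edges G - N - M, N)) = x"
      by (simp add: x)
  qed
  moreover have "card (Sigma PM F) = (\<Sum>M\<in>PM. card (F M))"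
    using finPM finF by (simp add: card_SigmaI)
  ultimately have "even (card {M \<in> PM. odd (card (F M))})"
    using even_sum_iff[OF finPM, of "\<lambda>M. card (F M)"] by simp
  moreover have "odd (card (F M)) \<longleftrightarrow> M \<in> ham_matchings G \<and> e \<notin> M" if M: "perfect_matching G M" for M
  proof (cases "e \<in> M")
    case True
    then have "F M = {}" by (auto simp: F_def)
    then show ?thesis using True by simp
  next
    case False
    show ?thesis
    proof (cases "connects (edges G - M) (verts G)")
      case True
      then have ham: "M \<in> ham_matchings G" using M by (simp add: ham_matchings_def)
      obtain N where N: "N \<in> F M"
        using colouring_of_hamiltonian_matching[OF simple cubic ham e False] by (auto simp: F_def)
      have "F M = {N}"
      proof (intro equalityI subsetI)
        fix N' assume "N' \<in> F M"
        then have "N' \<subseteq> N" "N \<subseteq> N'"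
          using N colouring_of_hamiltonian_matching_unique[OF simple cubic ham e] unfolding F_def by auto
        then show "N' \<in> {N}" by auto
      qed (use N in auto)
      then show ?thesis using ham False by simp
    next
      case ncon: False
      then show ?thesis
        using even_colourings_of_disconnected_matching[OF simple cubic M ncon e False]
        by (simp add: F_def ham_matchings_def)
    qed
  qed
  then have "{M \<in> PM. odd (card (F M))} = {M \<in> ham_matchings G. e \<notin> M}"
    by (auto simp: PM_def ham_matchings_def)
  ultimately show ?thesis by simp
qed

theorem not_one_or_two_hamiltonian_cycles:
  assumes simple: "simple_graph G" and cubic: "cubic G"
  shows "card (hamiltonian_cycles G) \<notin> {1, 2}"
proof
  let ?H = "ham_matchings G"
  have sub: "M \<subseteq> edges G" if "M \<in> ?H" for M
    using that by (simp add: ham_matchings_def perfect_matching_def)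
  have no1: "\<not> {M \<in> ?H. e \<notin> M} = {K}" if "e \<in> edges G" for e K
    using even_ham_matchings_avoiding_edge[OF simple cubic that] by (metis card_1_singleton_iff odd_one One_nat_def)
  assume "card (hamiltonian_cycles G) \<in> {1, 2}"
  then have "card ?H = 1 \<or> card ?H = 2" using card_hamiltonian_cycles[OF simple cubic] by simp
  then show False
  proof
    assume "card ?H = 1"
    then obtain M where M: "?H = {M}" by (auto simp: card_1_singleton_iff)
    have "edges G \<noteq> M"
    proof
      assume "edges G = M"
      then have pm: "perfect_matching G (edges G)" using M by (auto simp: ham_matchings_def)
      obtain v where v: "v \<in> verts G" using simple by (auto simp: simple_graph_def)
      obtain m where m: "\<forall>f\<in>edges G. v \<in> f \<longrightarrow> f = m" using perfect_matching_at[OF pm v] by metis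
      then have "{e \<in> edges G. v \<in> e} \<subseteq> {m}" by blast
      then have "card {e \<in> edges G. v \<in> e} \<le> 1" using card_mono[of "{m}"] by fastforce
      then show False using cubic v by (simp add: cubic_def)
    qed
    then obtain e where "e \<in> edges G" "e \<notin> M" using sub M by blast
    then show False using no1[of e M] M by auto
  next
    assume "card ?H = 2"
    then obtain M N where MN: "?H = {M, N}" "M \<noteq> N" by (auto simp: card_2_iff)
    obtain e where "e \<in> edges G" "e \<in> M \<longleftrightarrow> e \<notin> N" using MN sub by blast
    then show False using no1[of e M] no1[of e N] MN by auto
  qed
qed

section \<open>Cyclic connectivity\<close>

definition cut :: "'a sgraph \<Rightarrow> 'a set \<Rightarrow> 'a set set" where
  "cut G S = {e \<in> edges G. e \<inter> S \<noteq> {} \<and> \<not> e \<subseteq> S}"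

text \<open>For simple cubic graphs this is equivalent to cyclic 4-edge-connectivity: a set of at
  least two vertices that spans no cycle is left by at least four edges. It speaks of
  vertex sets only and is therefore easier to establish and to maintain.\<close>

definition four_cuts :: "'a sgraph \<Rightarrow> bool" where
  "four_cuts G \<longleftrightarrow> (\<forall>S\<subseteq>verts G. 2 \<le> card S \<and> 2 \<le> card (verts G - S) \<longrightarrow> 4 \<le> card (cut G S))"

lemma equiv_connection_rel: "equiv (verts G) (connection_rel G)"
proof (rule equivI)
  let ?r = "{(u, v). {u, v} \<in> edges G}"
  have "sym ?r" by (auto simp: sym_def insert_commute)
  then show "sym (connection_rel G)"
    unfolding connection_rel_def using sym_rtrancl[of ?r] by (auto simp: sym_def)
  show "trans (connection_rel G)"
    unfolding connection_rel_def by (auto simp: trans_def intro: rtrancl_trans)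
qed (auto simp: connection_rel_def refl_on_def)

lemma component_with_cycle_large:
  assumes "finite V" "(W, X) = A" "W \<subseteq> V" "contains_cycle A"
  shows "3 \<le> card W"
proof -
  obtain vs where "distinct vs" "length vs \<ge> 3" "set vs \<subseteq> W"
    using assms(2,4) by (auto simp: contains_cycle_def subgraph_def is_cycle_def)
  then show ?thesis
    using card_mono[of W "set vs"] finite_subset[OF assms(3,1)] by (simp add: distinct_card)
qed

text \<open>If removing \<open>F\<close> leaves two components with cycles, the edges leaving one of
  these components all belong to \<open>F\<close>.\<close>

lemma cyclically_edge_connectedI:
  assumes simple: "simple_graph G" and cuts: "four_cuts G"
  shows "cyclically_edge_connected 4 G"
  unfolding cyclically_edge_connected_def
proof (rule notI, elim exE conjE bexE)
  fix F A B
  assume F: "finite F" "card F < 4" and AB: "A \<noteq> B" "contains_cycle A" "contains_cycle B"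
    and A: "A \<in> graph_components (delete_edges G F)" and B: "B \<in> graph_components (delete_edges G F)"
  let ?H = "delete_edges G F"
  let ?r = "connection_rel ?H"
  have fin: "finite (verts G)" and E: "\<And>e. e \<in> edges G \<Longrightarrow> e \<subseteq> verts G \<and> card e = 2"
    using simple by (auto simp: simple_graph_def)
  have VH: "verts ?H = verts G" and EH: "edges ?H = edges G - F" by (simp_all add: delete_edges_def)
  note equiv = equiv_connection_rel[of ?H, unfolded VH]
  obtain W X where W: "A = (W, X)" "W \<in> verts G // ?r" "X = {e \<in> edges ?H. e \<subseteq> W}"
    using A by (auto simp: graph_components_def VH)
  obtain W' X' where W': "B = (W', X')" "W' \<in> verts G // ?r" "X' = {e \<in> edges ?H. e \<subseteq> W'}"
    using B by (auto simp: graph_components_def VH)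
  have "W \<noteq> W'" using AB W W' by auto
  then have disj: "W \<inter> W' = {}" using quotient_disj[OF equiv W(2) W'(2)] by blast
  have sub: "W \<subseteq> verts G" "W' \<subseteq> verts G" using W(2) W'(2) equiv by (auto dest: in_quotient_imp_subset)
  have "3 \<le> card W" using component_with_cycle_large[OF fin _ sub(1) AB(2)] W(1) by simp
  moreover have "3 \<le> card W'" using component_with_cycle_large[OF fin _ sub(2) AB(3)] W'(1) by simp
  moreover have "card W' \<le> card (verts G - W)" using disj sub fin by (intro card_mono) auto
  ultimately have "4 \<le> card (cut G W)" using cuts sub unfolding four_cuts_def by simp
  moreover have "cut G W \<subseteq> F"
  proof
    fix e assume "e \<in> cut G W"
    then have e: "e \<in> edges G" "e \<inter> W \<noteq> {}" "\<not> e \<subseteq> W" by (auto simp: cut_def)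
    then obtain u v where uv: "u \<in> e" "u \<in> W" "v \<in> e" "v \<notin> W" by blast
    have "u \<noteq> v" using uv by blast
    then have euv: "e = {u, v}" using E[OF e(1)] uv by (auto simp: card_2_iff)
    show "e \<in> F"
    proof (rule ccontr)
      assume "e \<notin> F"
      then have "(u, v) \<in> ?r" using e(1) euv E[OF e(1)] by (auto simp: connection_rel_def VH EH)
      then have "v \<in> W" using in_quotient_imp_closed[OF equiv W(2) uv(2)] by blast
      then show False using uv by simp
    qed
  qed
  then have "card (cut G W) \<le> card F" using F by (intro card_mono)
  ultimately show False using F by linarith
qed

section \<open>Straight-line drawings\<close>

text \<open>Twice the signed area of a triangle.\<close>

definition orient :: "complex \<Rightarrow> complex \<Rightarrow> complex \<Rightarrow> real" where
  "orient a b c = (Re b - Re a) * (Im c - Im a) - (Im b - Im a) * (Re c - Re a)"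

lemma disjoint_hulls_of_halfspaces:
  fixes w :: complex
  assumes "\<And>z. z \<in> A \<Longrightarrow> t < w \<bullet> z" "\<And>z. z \<in> B \<Longrightarrow> w \<bullet> z \<le> t"
  shows "convex hull A \<inter> convex hull B = {}"
proof -
  have "convex hull A \<subseteq> {z. w \<bullet> z > t}"
    by (rule hull_minimal) (use assms convex_halfspace_gt in auto)
  moreover have "convex hull B \<subseteq> {z. w \<bullet> z \<le> t}"
    by (rule hull_minimal) (use assms convex_halfspace_le in auto)
  ultimately show ?thesis by fastforce
qed

lemma orient_inner:
  "orient a b z = Complex (- (Im b - Im a)) (Re b - Re a) \<bullet> z -
     Complex (- (Im b - Im a)) (Re b - Re a) \<bullet> a"
  by (simp add: orient_def inner_complex_def algebra_simps)

text \<open>The line through \<open>a\<close> and \<open>b\<close> has \<open>c\<close> and \<open>d\<close>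
  strictly on the same side.\<close>

lemma disjoint_segments:
  assumes "orient a b c * orient a b d > 0"
  shows "convex hull {a, b} \<inter> convex hull {c, d} = {}"
proof -
  let ?w = "Complex (- (Im b - Im a)) (Re b - Re a)"
  have ab: "orient a b a = 0" "orient a b b = 0" by (simp_all add: orient_def)
  consider "orient a b c > 0" "orient a b d > 0" | "orient a b c < 0" "orient a b d < 0"
    using assms by (auto simp: zero_less_mult_iff)
  then show ?thesis
  proof cases
    case 1
    have "convex hull {c, d} \<inter> convex hull {a, b} = {}"
      by (rule disjoint_hulls_of_halfspaces[where w = ?w and t = "?w \<bullet> a"])
        (use 1 ab in \<open>auto simp: orient_inner[of a b]\<close>)
    then show ?thesis by blast
  next
    case 2
    have "convex hull {c, d} \<inter> convex hull {a, b} = {}"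
      by (rule disjoint_hulls_of_halfspaces[where w = "- ?w" and t = "- ?w \<bullet> a"])
        (use 2 ab in \<open>auto simp: orient_inner[of a b] inner_minus_left simp del: complex_minus minus_complex.ctr\<close>)
    then show ?thesis by blast
  qed
qed

text \<open>The lines through \<open>a\<close>, \<open>b\<close> and through \<open>a\<close>,
  \<open>c\<close> are different.\<close>

lemma adjacent_segments:
  assumes "orient a b c \<noteq> 0"
  shows "convex hull {a, b} \<inter> convex hull {a, c} \<subseteq> {a}"
proof
  fix z assume z: "z \<in> convex hull {a, b} \<inter> convex hull {a, c}"
  then obtain s where s: "z = (1 - s) *\<^sub>R a + s *\<^sub>R b"
    by (auto simp: segment_convex_hull[symmetric] in_segment)
  obtain t where t: "z = (1 - t) *\<^sub>R a + t *\<^sub>R c"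
    using z by (auto simp: segment_convex_hull[symmetric] in_segment)
  have "orient a b z = 0" unfolding s by (simp add: orient_def algebra_simps)
  moreover have "orient a b z = t * orient a b c" unfolding t by (simp add: orient_def algebra_simps)
  ultimately have "t = 0" using assms by simp
  then show "z \<in> {a}" using t by simp
qed

definition cross_free :: "('a \<Rightarrow> complex) \<Rightarrow> 'a set \<Rightarrow> 'a set \<Rightarrow> bool" where
  "cross_free p e f \<longleftrightarrow> convex hull (p ` e) \<inter> convex hull (p ` f) \<subseteq> p ` (e \<inter> f)"

lemma cross_free_sym: "cross_free p e f \<longleftrightarrow> cross_free p f e"
  by (simp add: cross_free_def Int_commute)

lemma cross_free_disjoint:
  assumes "orient (p a) (p b) (p c) * orient (p a) (p b) (p d) > 0"
  shows "cross_free p {a, b} {c, d}"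
  using disjoint_segments[OF assms] by (simp add: cross_free_def)

lemma cross_free_adjacent:
  assumes "orient (p a) (p b) (p c) \<noteq> 0"
  shows "cross_free p {a, b} {a, c}"
  using adjacent_segments[OF assms] by (auto simp: cross_free_def)

text \<open>A vertex in the interior of an edge is excluded as well: it is the end of another edge,
  which would then be crossed.\<close>

lemma planar_straight_line:
  assumes simple: "simple_graph G" and cubic: "cubic G" and inj: "inj_on p (verts G)"
    and free: "\<And>e f. e \<in> edges G \<Longrightarrow> f \<in> edges G \<Longrightarrow> e \<noteq> f \<Longrightarrow> cross_free p e f"
  shows "planar G"
proof -
  have E: "\<And>e. e \<in> edges G \<Longrightarrow> e \<subseteq> verts G \<and> card e = 2"
    using simple by (auto simp: simple_graph_def)
  have "\<forall>e\<in>edges G. \<exists>ab. e = {fst ab, snd ab} \<and> fst ab \<noteq> snd ab"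
    using E by (fastforce simp: card_2_iff)
  then obtain q where q: "\<And>e. e \<in> edges G \<Longrightarrow> e = {fst (q e), snd (q e)} \<and> fst (q e) \<noteq> snd (q e)"
    by metis
  define \<gamma> where "\<gamma> e = linepath (p (fst (q e))) (p (snd (q e)))" for e
  have pe: "p ` e = {p (fst (q e)), p (snd (q e))}" if "e \<in> edges G" for e
    using q[OF that] by (metis image_empty image_insert)
  have img: "path_image (\<gamma> e) = convex hull (p ` e)" if "e \<in> edges G" for e
    by (simp add: \<gamma>_def segment_convex_hull pe[OF that])
  have "plane_drawing G p \<gamma>"
    unfolding plane_drawing_def
  proof (intro conjI ballI impI)
    show "inj_on p (verts G)" by fact
  next
    fix e assume e: "e \<in> edges G"
    have "p (fst (q e)) \<noteq> p (snd (q e))"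
      using inj q[OF e] E[OF e] by (metis inj_on_contraD insert_subset)
    then show "arc (\<gamma> e)" by (simp add: \<gamma>_def arc_linepath)
    show "{pathstart (\<gamma> e), pathfinish (\<gamma> e)} = p ` e" using pe[OF e] by (simp add: \<gamma>_def)
  next
    fix e assume e: "e \<in> edges G"
    have "p v \<in> p ` e" if v: "v \<in> verts G" "p v \<in> convex hull (p ` e)" for v
    proof -
      have c: "card {f \<in> edges G. v \<in> f} = 3" using cubic v(1) by (simp add: cubic_def)
      have "\<exists>f. f \<in> edges G \<and> v \<in> f \<and> f \<noteq> e"
      proof (rule ccontr)
        assume "\<not> ?thesis"
        then have "{f \<in> edges G. v \<in> f} \<subseteq> {e}" by blast
        then show False using c card_mono[of "{e}" "{f \<in> edges G. v \<in> f}"] by simp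
      qed
      then obtain f where f: "f \<in> edges G" "v \<in> f" "f \<noteq> e" by blast
      have "p v \<in> convex hull (p ` f)" using f(2) by (intro hull_inc imageI)
      then show ?thesis using free[OF e f(1)] f(3) v(2) by (auto simp: cross_free_def)
    qed
    then show "(path_image (\<gamma> e) - p ` e) \<inter> p ` verts G = {}" using img[OF e] by auto
  next
    fix e f assume ef: "e \<in> edges G" "f \<in> edges G" "e \<noteq> f"
    show "(path_image (\<gamma> e) - p ` e) \<inter> path_image (\<gamma> f) = {}"
      using free[OF ef] by (auto simp: img[OF ef(1)] img[OF ef(2)] cross_free_def)
  qed
  then show ?thesis unfolding planar_def by blast
qed

section \<open>Prisms\<close>

text \<open>Vertex \<open>i\<close> of one of the two polygons of a prism. The index is read modulo
  \<open>n\<close>, so that rungs and rails are periodic families indexed by all natural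
  numbers and no case distinction is needed where the polygon closes up. Neighbourhoods
  are described at \<open>Suc i\<close>, which avoids subtraction.\<close>

definition vtx :: "nat \<Rightarrow> bool \<Rightarrow> nat \<Rightarrow> nat" where
  "vtx n s i = 2 * (i mod n) + of_bool s"

definition rung :: "nat \<Rightarrow> nat \<Rightarrow> nat set" where
  "rung n i = {vtx n False i, vtx n True i}"

definition rail :: "nat \<Rightarrow> bool \<Rightarrow> nat \<Rightarrow> nat set" where
  "rail n s i = {vtx n s i, vtx n s (Suc i)}"

definition prism :: "nat \<Rightarrow> nat sgraph" where
  "prism n = ({..<2 * n}, range (rung n) \<union> (\<Union>s. range (rail n s)))"

lemma vtx_eq_iff [simp]: "vtx n s i = vtx n t j \<longleftrightarrow> s = t \<and> i mod n = j mod n"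
proof -
  have "2 * x + of_bool s = 2 * y + (of_bool t :: nat) \<longleftrightarrow> s = t \<and> x = y" for x y
    by (cases s; cases t; simp; arith)
  then show ?thesis by (simp add: vtx_def)
qed

lemma Suc_mod_eq_iff: "Suc i mod n = Suc j mod n \<longleftrightarrow> i mod n = j mod n"
proof (cases "n = 0")
  case False
  then have "i mod n < n" "j mod n < n" by auto
  then show ?thesis by (auto simp: mod_Suc)
qed simp

lemma Suc_mod_neq: "2 \<le> n \<Longrightarrow> Suc i mod n \<noteq> i mod n"
  by (auto simp: mod_Suc)

lemma Suc_Suc_mod_neq: "3 \<le> n \<Longrightarrow> Suc (Suc i) mod n \<noteq> i mod n"
  by (auto simp: mod_Suc)

lemma verts_prism: "0 < n \<Longrightarrow> verts (prism n) = {vtx n s i | s i. True}"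
proof (intro equalityI subsetI)
  fix v assume n: "0 < n" and "v \<in> verts (prism n)"
  then have v: "v < 2 * n" by (simp add: prism_def)
  have "v = vtx n (odd v) (v div 2)"
    using v by (simp add: vtx_def less_mult_imp_div_less mult.commute)
  then show "v \<in> {vtx n s i | s i. True}" by blast
next
  fix v assume n: "0 < n" and "v \<in> {vtx n s i | s i. True}"
  then obtain s i where "v = 2 * (i mod n) + of_bool s" by (auto simp: vtx_def)
  moreover have "i mod n < n" using n by simp
  ultimately show "v \<in> verts (prism n)" by (cases s) (auto simp: prism_def)
qed

lemma edges_prism: "edges (prism n) = range (rung n) \<union> (\<Union>s. range (rail n s))"
  by (simp add: prism_def)

lemma rung_in_prism [simp]: "rung n i \<in> edges (prism n)"
  and rail_in_prism [simp]: "rail n s i \<in> edges (prism n)"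
  by (auto simp: edges_prism)

lemma vtx_in_prism: "0 < n \<Longrightarrow> vtx n s i \<in> verts (prism n)"
  by (auto simp: verts_prism)

lemma rung_eq_iff: "rung n i = rung n j \<longleftrightarrow> i mod n = j mod n"
  unfolding rung_def by (auto simp: doubleton_eq_iff)

lemma rung_neq_rail: "rung n i \<noteq> rail n s j"
  unfolding rung_def rail_def by (auto simp: doubleton_eq_iff)

lemma rail_eq_iff:
  assumes "3 \<le> n"
  shows "rail n s i = rail n t j \<longleftrightarrow> s = t \<and> i mod n = j mod n"
  unfolding rail_def using Suc_Suc_mod_neq[OF assms] Suc_mod_eq_iff
  by (auto simp: doubleton_eq_iff) (metis Suc_mod_eq_iff)+

lemma vtx_in_rung_iff: "vtx n s i \<in> rung n j \<longleftrightarrow> i mod n = j mod n"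
  by (cases s) (auto simp: rung_def)

lemma vtx_Suc_in_rail_iff:
  "vtx n s (Suc i) \<in> rail n t j \<longleftrightarrow> s = t \<and> (Suc i mod n = j mod n \<or> i mod n = j mod n)"
  by (auto simp: rail_def Suc_mod_eq_iff)

lemma edge_at_prism_iff:
  assumes "3 \<le> n"
  shows "e \<in> edges (prism n) \<and> vtx n s (Suc i) \<in> e \<longleftrightarrow>
    e = rung n (Suc i) \<or> e = rail n s i \<or> e = rail n s (Suc i)"
proof
  assume e: "e \<in> edges (prism n) \<and> vtx n s (Suc i) \<in> e"
  then consider j where "e = rung n j" | t j where "e = rail n t j" by (auto simp: edges_prism)
  then show "e = rung n (Suc i) \<or> e = rail n s i \<or> e = rail n s (Suc i)"
  proof cases
    case (1 j)
    then show ?thesis using e by (simp add: vtx_in_rung_iff rung_eq_iff)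
  next
    case (2 t j)
    then show ?thesis using e by (auto simp: vtx_Suc_in_rail_iff rail_eq_iff[OF assms])
  qed
qed (auto simp: vtx_in_rung_iff vtx_Suc_in_rail_iff)

lemma prism_vertex_Suc:
  assumes "0 < n" "v \<in> verts (prism n)"
  obtains s i where "v = vtx n s (Suc i)"
proof -
  obtain s i where "v = vtx n s i" using assms by (auto simp: verts_prism)
  then have "v = vtx n s (Suc (i + n - 1))" using assms by (simp add: vtx_def)
  then show ?thesis by (rule that)
qed

lemma simple_graph_prism:
  assumes "2 \<le> n"
  shows "simple_graph (prism n)"
proof -
  have "0 < n" using assms by simp
  moreover have "0 \<in> verts (prism n)" "finite (verts (prism n))" using assms by (simp_all add: prism_def)
  moreover have "card (rung n i) = 2" "card (rail n s i) = 2" for s i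
    using Suc_mod_neq[OF assms, of i] by (auto simp: rung_def rail_def card_insert_if)
  moreover have "rung n i \<subseteq> verts (prism n)" "rail n s i \<subseteq> verts (prism n)" for s i
    using \<open>0 < n\<close> by (auto simp: rung_def rail_def verts_prism)
  ultimately show ?thesis unfolding simple_graph_def edges_prism by blast
qed

lemma prism_edges_distinct:
  assumes "3 \<le> n"
  shows "rung n (Suc i) \<noteq> rail n s i" "rung n (Suc i) \<noteq> rail n s (Suc i)" "rail n s i \<noteq> rail n s (Suc i)"
  using assms Suc_mod_neq[of n i] rung_neq_rail by (auto simp: rail_eq_iff)

lemma cubic_prism:
  assumes n: "3 \<le> n"
  shows "cubic (prism n)"
  unfolding cubic_def
proof
  fix v assume "v \<in> verts (prism n)"
  then obtain s i where v: "v = vtx n s (Suc i)" using prism_vertex_Suc[of n v] n by auto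
  have "{e \<in> edges (prism n). v \<in> e} = {rung n (Suc i), rail n s i, rail n s (Suc i)}"
    unfolding v using edge_at_prism_iff[OF n, of _ s i] by blast
  then show "card {e \<in> edges (prism n). v \<in> e} = 3"
    using prism_edges_distinct[OF n, where i = i and s = s] by (simp add: card_insert_if)
qed

text \<open>Going around the cycle from a point inside to a point outside, one leaves at some
  moment.\<close>

lemma cyclic_change:
  fixes X :: "nat \<Rightarrow> bool"
  assumes per: "\<And>i. X (i + n) = X i" and a: "X a" and b: "\<not> X b" and n: "0 < n"
  shows "\<exists>i. X i \<and> \<not> X (Suc i)"
proof (rule ccontr)
  assume *: "\<nexists>i. X i \<and> \<not> X (Suc i)"
  have "X (a + k)" for k by (induction k) (use a * in auto)
  moreover have "X (b + k * n) = X b" for k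
    by (induction k) (use per[of "b + _ * n"] in \<open>simp_all add: algebra_simps\<close>)
  moreover have "a \<le> b + a * n" using n by (simp add: trans_le_add2)
  ultimately show False using b by (metis le_add_diff_inverse)
qed

lemma rail_in_cut_iff: "rail n s i \<in> cut (prism n) S \<longleftrightarrow> (vtx n s i \<in> S \<longleftrightarrow> vtx n s (Suc i) \<notin> S)"
proof -
  have "rail n s i \<inter> S \<noteq> {} \<and> \<not> rail n s i \<subseteq> S \<longleftrightarrow> (vtx n s i \<in> S \<longleftrightarrow> vtx n s (Suc i) \<notin> S)"
    unfolding rail_def by blast
  then show ?thesis by (simp add: cut_def)
qed

lemma rung_in_cut_iff: "rung n i \<in> cut (prism n) S \<longleftrightarrow> (vtx n False i \<in> S \<longleftrightarrow> vtx n True i \<notin> S)"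
proof -
  have "rung n i \<inter> S \<noteq> {} \<and> \<not> rung n i \<subseteq> S \<longleftrightarrow> (vtx n False i \<in> S \<longleftrightarrow> vtx n True i \<notin> S)"
    unfolding rung_def by blast
  then show ?thesis by (simp add: cut_def)
qed

lemma two_rails_in_cut:
  assumes n: "3 \<le> n" and a: "vtx n s a \<in> S" and b: "vtx n s b \<notin> S"
  obtains i j where "rail n s i \<in> cut (prism n) S" "rail n s j \<in> cut (prism n) S" "rail n s i \<noteq> rail n s j"
proof -
  have per: "vtx n s (i + n) = vtx n s i" for i by simp
  obtain i where i: "vtx n s i \<in> S" "vtx n s (Suc i) \<notin> S"
    using cyclic_change[of "\<lambda>i. vtx n s i \<in> S" n a b] a b n per by auto
  obtain j where j: "vtx n s j \<notin> S" "vtx n s (Suc j) \<in> S"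
    using cyclic_change[of "\<lambda>i. vtx n s i \<notin> S" n b a] a b n per by auto
  have "rail n s i \<noteq> rail n s j"
    using i j by (metis rail_eq_iff[OF n] vtx_eq_iff)
  then show ?thesis using that[of i j] i j by (simp add: rail_in_cut_iff)
qed

lemma obtain_two:
  assumes "2 \<le> card A"
  obtains a b where "a \<in> A" "b \<in> A" "a \<noteq> b"
  using assms by (metis card_le_Suc0_iff_eq card.infinite not_less_eq_eq numeral_2_eq_2 zero_le)

text \<open>A polygon that \<open>S\<close> meets but does not contain contributes at least two rails
  to the cut. If only one of the polygons is of this kind, the rungs at those of its
  vertices that are separated from the other polygon make up for the missing rails. If
  none is, then \<open>S\<close> is one of the two polygons and all rungs belong to the cut.\<close>

lemma four_cuts_prism:
  assumes n: "4 \<le> n"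
  shows "four_cuts (prism n)"
  unfolding four_cuts_def
proof (intro allI impI, elim conjE)
  fix S assume S: "S \<subseteq> verts (prism n)" "2 \<le> card S" "2 \<le> card (verts (prism n) - S)"
  let ?C = "cut (prism n) S"
  have n3: "3 \<le> n" and n0: "0 < n" using n by auto
  have "edges (prism n) \<subseteq> Pow (verts (prism n))"
    using simple_graph_prism[of n] n by (auto simp: simple_graph_def)
  then have "finite (edges (prism n))"
    by (rule finite_subset) (simp add: prism_def)
  then have fin: "finite ?C" by (rule finite_subset[rotated]) (auto simp: cut_def)
  have four: "4 \<le> card ?C" if "{w, x, y, z} \<subseteq> ?C" "card {w, x, y, z} = 4" for w x y z
    using card_mono[OF fin that(1)] that(2) by simp
  define mixed where "mixed s \<longleftrightarrow> (\<exists>a b. vtx n s a \<in> S \<and> vtx n s b \<notin> S)" for s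
  have two_and_two: "4 \<le> card ?C" if mix: "mixed s" and const: "\<not> mixed (\<not> s)" for s
  proof -
    obtain i j where ij: "rail n s i \<in> ?C" "rail n s j \<in> ?C" "rail n s i \<noteq> rail n s j"
      using mix two_rails_in_cut[OF n3] unfolding mixed_def by metis
    \<comment> \<open>These vertices are separated from the other polygon, so all of them lie on
      polygon \<open>s\<close>.\<close>
    let ?T = "if vtx n (\<not> s) 0 \<in> S then verts (prism n) - S else S"
    have T: "v \<in> ?T \<Longrightarrow> v \<in> verts (prism n)" "2 \<le> card ?T" for v using S by (auto split: if_splits)
    then obtain v w where vw: "v \<in> ?T" "w \<in> ?T" "v \<noteq> w" using obtain_two by blast
    have on_s: "\<exists>i. x = vtx n s i \<and> rung n i \<in> ?C" if x: "x \<in> ?T" for x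
    proof -
      obtain t k where x': "x = vtx n t k" using T(1)[OF x] n0 by (auto simp: verts_prism)
      have c: "vtx n (\<not> s) k \<in> S \<longleftrightarrow> vtx n (\<not> s) 0 \<in> S" using const unfolding mixed_def by blast
      then have "t = s" using x x' by (cases "t = s") (auto split: if_splits)
      moreover have "rung n k \<in> ?C" using x x' c \<open>t = s\<close>
        by (cases s) (auto simp: rung_in_cut_iff split: if_splits)
      ultimately show ?thesis using x' by blast
    qed
    obtain k where k: "v = vtx n s k" "rung n k \<in> ?C" using on_s[OF vw(1)] by blast
    obtain l where l: "w = vtx n s l" "rung n l \<in> ?C" using on_s[OF vw(2)] by blast
    have "rung n k \<noteq> rung n l" using vw k l by (auto simp: rung_eq_iff)
    then have "card {rail n s i, rail n s j, rung n k, rung n l} = 4"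
      using ij(3) rung_neq_rail by (auto simp: card_insert_if dest: sym)
    then show ?thesis using four ij k l by blast
  qed
  show "4 \<le> card ?C"
  proof (cases "mixed False")
    case F: True
    show ?thesis
    proof (cases "mixed True")
      case True
      obtain i j where ij: "rail n False i \<in> ?C" "rail n False j \<in> ?C" "rail n False i \<noteq> rail n False j"
        using F two_rails_in_cut[OF n3] unfolding mixed_def by metis
      obtain k l where kl: "rail n True k \<in> ?C" "rail n True l \<in> ?C" "rail n True k \<noteq> rail n True l"
        using True two_rails_in_cut[OF n3] unfolding mixed_def by metis
      have "card {rail n False i, rail n False j, rail n True k, rail n True l} = 4"
        using ij(3) kl(3) by (simp add: card_insert_if rail_eq_iff[OF n3])
      then show ?thesis using four ij kl by blast
    qed (use two_and_two[of False] F in simp)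
  next
    case F: False
    show ?thesis
    proof (cases "mixed True")
      case False
      have c: "vtx n s i \<in> S \<longleftrightarrow> vtx n s 0 \<in> S" for s i
      proof -
        have "\<not> mixed s" using F False by (cases s) simp_all
        then show ?thesis unfolding mixed_def by blast
      qed
      have "vtx n False 0 \<in> S \<longleftrightarrow> vtx n True 0 \<notin> S"
      proof (rule ccontr)
        assume "\<not> ?thesis"
        then have "vtx n s 0 \<in> S \<longleftrightarrow> vtx n False 0 \<in> S" for s by (cases s) simp_all
        then have "vtx n s i \<in> S \<longleftrightarrow> vtx n False 0 \<in> S" for s i using c by blast
        then have "verts (prism n) \<subseteq> S \<or> verts (prism n) \<inter> S = {}"
          unfolding verts_prism[OF n0] by blast
        then have "S = {} \<or> verts (prism n) - S = {}" using S(1) by blast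
        then have "card S = 0 \<or> card (verts (prism n) - S) = 0" by (metis card.empty)
        then show False using S(2,3) by linarith
      qed
      then have R: "rung n i \<in> ?C" for i
        using c[of False i] c[of True i] by (simp add: rung_in_cut_iff)
      have "card {rung n 0, rung n 1, rung n 2, rung n 3} = 4"
        using n by (simp add: card_insert_if rung_eq_iff)
      then show ?thesis using four R by blast
    qed (use two_and_two[of True] F in simp)
  qed
qed

section \<open>Hamiltonian cycles of prisms\<close>

definition exactly_one :: "bool \<Rightarrow> bool \<Rightarrow> bool \<Rightarrow> bool" where
  "exactly_one a b c \<longleftrightarrow> (a \<or> b \<or> c) \<and> \<not> (a \<and> b) \<and> \<not> (a \<and> c) \<and> \<not> (b \<and> c)"

lemma ex1_iff_exactly_one:
  assumes "x \<noteq> y" "x \<noteq> z" "y \<noteq> z"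
  shows "(\<exists>!e. e \<in> M \<and> (e = x \<or> e = y \<or> e = z)) \<longleftrightarrow> exactly_one (x \<in> M) (y \<in> M) (z \<in> M)"
  using assms by (cases "x \<in> M"; cases "y \<in> M"; cases "z \<in> M") (auto simp: exactly_one_def Ex1_def)

lemma perfect_matching_prism_iff:
  assumes n: "3 \<le> n"
  shows "perfect_matching (prism n) M \<longleftrightarrow> M \<subseteq> edges (prism n) \<and>
    (\<forall>s i. exactly_one (rung n (Suc i) \<in> M) (rail n s i \<in> M) (rail n s (Suc i) \<in> M))"
proof -
  have n0: "0 < n" using n by simp
  have "(\<forall>v\<in>verts (prism n). P v) \<longleftrightarrow> (\<forall>s i. P (vtx n s (Suc i)))" for P
    using prism_vertex_Suc[OF n0] vtx_in_prism[OF n0] by metis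
  moreover have "(\<exists>!e. e \<in> M \<and> vtx n s (Suc i) \<in> e) \<longleftrightarrow>
      exactly_one (rung n (Suc i) \<in> M) (rail n s i \<in> M) (rail n s (Suc i) \<in> M)"
    if "M \<subseteq> edges (prism n)" for s i
  proof -
    have "e \<in> M \<and> vtx n s (Suc i) \<in> e \<longleftrightarrow>
        e \<in> M \<and> (e = rung n (Suc i) \<or> e = rail n s i \<or> e = rail n s (Suc i))" for e
      using edge_at_prism_iff[OF n, of e s i] that by blast
    then show ?thesis
      using ex1_iff_exactly_one[OF prism_edges_distinct[OF n, where i = i and s = s]] by simp
  qed
  ultimately show ?thesis unfolding perfect_matching_def by (intro conj_cong refl) simp
qed

lemma connects_prism_iff:
  assumes n: "0 < n"
  shows "connects (edges (prism n) - M) (verts (prism n)) \<longleftrightarrow>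
    (\<forall>S. (\<forall>s i. rail n s i \<notin> M \<longrightarrow> (vtx n s i \<in> S \<longleftrightarrow> vtx n s (Suc i) \<in> S)) \<and>
         (\<forall>i. rung n i \<notin> M \<longrightarrow> (vtx n False i \<in> S \<longleftrightarrow> vtx n True i \<in> S)) \<longrightarrow>
         (\<forall>s i. vtx n s i \<in> S) \<or> (\<forall>s i. vtx n s i \<notin> S))"
proof -
  have "rail n s i \<subseteq> S \<or> rail n s i \<inter> S = {} \<longleftrightarrow> (vtx n s i \<in> S \<longleftrightarrow> vtx n s (Suc i) \<in> S)" for s i S
    unfolding rail_def by blast
  moreover have "rung n i \<subseteq> S \<or> rung n i \<inter> S = {} \<longleftrightarrow> (vtx n False i \<in> S \<longleftrightarrow> vtx n True i \<in> S)" for i S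
    unfolding rung_def by blast
  moreover have "(\<forall>e\<in>edges (prism n) - M. P e) \<longleftrightarrow>
      (\<forall>s i. rail n s i \<notin> M \<longrightarrow> P (rail n s i)) \<and> (\<forall>i. rung n i \<notin> M \<longrightarrow> P (rung n i))" for P
    unfolding edges_prism by blast
  moreover have "verts (prism n) \<subseteq> S \<longleftrightarrow> (\<forall>s i. vtx n s i \<in> S)"
    "verts (prism n) \<inter> S = {} \<longleftrightarrow> (\<forall>s i. vtx n s i \<notin> S)" for S
    unfolding verts_prism[OF n] by blast+
  ultimately show ?thesis unfolding connects_def by simp
qed

text \<open>The matching that is avoided by the hamiltonian cycle whose only rungs are
  \<open>j\<close> and \<open>j + 1\<close>.\<close>

definition one_gap :: "nat \<Rightarrow> nat \<Rightarrow> nat set set" where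
  "one_gap n j = {rail n False j, rail n True j} \<union>
     {rung n i | i. i mod n \<noteq> j mod n \<and> i mod n \<noteq> Suc j mod n}"

text \<open>The matching that is avoided by a hamiltonian cycle using all rungs, for even
  \<open>n\<close>.\<close>

definition zigzag :: "nat \<Rightarrow> bool \<Rightarrow> nat set set" where
  "zigzag n b = {rail n s i | s i. even i \<longleftrightarrow> s = b}"

lemma rail_in_one_gap_iff:
  assumes "3 \<le> n"
  shows "rail n s i \<in> one_gap n j \<longleftrightarrow> i mod n = j mod n"
  using rung_neq_rail[symmetric] by (cases s) (auto simp: one_gap_def rail_eq_iff[OF assms])

lemma rung_in_one_gap_iff:
  "rung n i \<in> one_gap n j \<longleftrightarrow> i mod n \<noteq> j mod n \<and> i mod n \<noteq> Suc j mod n"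
  using rung_neq_rail by (auto simp: one_gap_def rung_eq_iff)

lemma rail_in_zigzag_iff:
  assumes "3 \<le> n" "even n"
  shows "rail n s i \<in> zigzag n b \<longleftrightarrow> (even i \<longleftrightarrow> s = b)"
proof -
  have "even i \<longleftrightarrow> even j" if "i mod n = j mod n" for i j :: nat
    using dvd_mod_iff[OF assms(2), of i] dvd_mod_iff[OF assms(2), of j] that by simp
  moreover have "rail n s i \<in> zigzag n b \<longleftrightarrow> (\<exists>j. i mod n = j mod n \<and> (even j \<longleftrightarrow> s = b))"
    unfolding zigzag_def mem_Collect_eq rail_eq_iff[OF assms(1)] by blast
  ultimately show ?thesis by blast
qed

lemma rung_notin_zigzag: "rung n i \<notin> zigzag n b"
  using rung_neq_rail by (auto simp: zigzag_def)

lemma one_gap_ham: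
  assumes n: "3 \<le> n"
  shows "one_gap n j \<in> ham_matchings (prism n)"
proof -
  have n0: "0 < n" using n by simp
  have "one_gap n j \<subseteq> edges (prism n)" by (auto simp: one_gap_def)
  moreover have "exactly_one (rung n (Suc i) \<in> one_gap n j) (rail n s i \<in> one_gap n j)
      (rail n s (Suc i) \<in> one_gap n j)" for s i
    unfolding exactly_one_def rail_in_one_gap_iff[OF n] rung_in_one_gap_iff Suc_mod_eq_iff
    using Suc_mod_neq[of n i] n by auto
  moreover have "connects (edges (prism n) - one_gap n j) (verts (prism n))"
    unfolding connects_prism_iff[OF n0] rail_in_one_gap_iff[OF n] rung_in_one_gap_iff
  proof (intro allI impI, elim conjE)
    fix S
    assume rails: "\<forall>s i. i mod n \<noteq> j mod n \<longrightarrow> (vtx n s i \<in> S \<longleftrightarrow> vtx n s (Suc i) \<in> S)"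
      and rungs: "\<forall>i. \<not> (i mod n \<noteq> j mod n \<and> i mod n \<noteq> Suc j mod n) \<longrightarrow>
        (vtx n False i \<in> S \<longleftrightarrow> vtx n True i \<in> S)"
    have walk: "vtx n s (Suc j + k) \<in> S \<longleftrightarrow> vtx n s (Suc j) \<in> S" if "k < n" for s k
      using that
    proof (induction k)
      case (Suc k)
      have "(Suc j + k) mod n \<noteq> j mod n"
      proof
        assume "(Suc j + k) mod n = j mod n"
        then have "n dvd Suc k" by (metis add.commute add_Suc_right add_diff_cancel_right' add_Suc_shift le_add2 mod_eq_dvd_iff_nat)
        then show False using Suc.prems by (auto dest: dvd_imp_le)
      qed
      then have "vtx n s (Suc j + k) \<in> S \<longleftrightarrow> vtx n s (Suc (Suc j + k)) \<in> S" using rails by blast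
      then show ?case using Suc by simp
    qed simp
    have "vtx n s i \<in> S \<longleftrightarrow> vtx n s (Suc j) \<in> S" for s i
    proof -
      \<comment> \<open>The distance from \<open>j + 1\<close> to \<open>i\<close>; the summand \<open>n *
        Suc j\<close> prevents truncation.\<close>
      define k where "k = (i + n * Suc j - Suc j) mod n"
      have "1 * Suc j \<le> n * Suc j" using n by (intro mult_le_mono1) simp
      then have le: "Suc j \<le> i + n * Suc j" unfolding mult_1 by (rule trans_le_add2)
      have "(Suc j + k) mod n = (Suc j + (i + n * Suc j - Suc j)) mod n"
        unfolding k_def by (rule mod_add_right_eq)
      also have "\<dots> = (i + n * Suc j) mod n" using le by (simp only: le_add_diff_inverse)
      also have "\<dots> = i mod n" by (rule mod_mult_self2)
      finally have "(Suc j + k) mod n = i mod n" .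
      then have "vtx n s (Suc j + k) = vtx n s i" by simp
      moreover have "k < n" using n0 by (simp add: k_def)
      ultimately show ?thesis using walk by metis
    qed
    moreover have "vtx n False (Suc j) \<in> S \<longleftrightarrow> vtx n True (Suc j) \<in> S" using rungs by blast
    then have "vtx n s (Suc j) \<in> S \<longleftrightarrow> vtx n False (Suc j) \<in> S" for s by (cases s) simp_all
    ultimately show "(\<forall>s i. vtx n s i \<in> S) \<or> (\<forall>s i. vtx n s i \<notin> S)" by blast
  qed
  ultimately show ?thesis unfolding ham_matchings_def perfect_matching_prism_iff[OF n] by blast
qed

lemma zigzag_ham:
  assumes n: "3 \<le> n" and ev: "even n"
  shows "zigzag n b \<in> ham_matchings (prism n)"
proof -
  have n0: "0 < n" using n by simp
  have "zigzag n b \<subseteq> edges (prism n)" by (auto simp: zigzag_def)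
  moreover have "exactly_one (rung n (Suc i) \<in> zigzag n b) (rail n s i \<in> zigzag n b)
      (rail n s (Suc i) \<in> zigzag n b)" for s i
    unfolding exactly_one_def rail_in_zigzag_iff[OF n ev] using rung_notin_zigzag by auto
  moreover have "connects (edges (prism n) - zigzag n b) (verts (prism n))"
    unfolding connects_prism_iff[OF n0] rail_in_zigzag_iff[OF n ev]
  proof (intro allI impI, elim conjE)
    fix S
    assume rails: "\<forall>s i. \<not> (even i \<longleftrightarrow> s = b) \<longrightarrow> (vtx n s i \<in> S \<longleftrightarrow> vtx n s (Suc i) \<in> S)"
      and rungs: "\<forall>i. rung n i \<notin> zigzag n b \<longrightarrow> (vtx n False i \<in> S \<longleftrightarrow> vtx n True i \<in> S)"
    have same: "vtx n s i \<in> S \<longleftrightarrow> vtx n b i \<in> S" for s i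
      using rungs rung_notin_zigzag by (cases s; cases b) auto
    have "vtx n b (Suc i) \<in> S \<longleftrightarrow> vtx n b i \<in> S" for i
      using rails same[of "\<not> b" i] same[of "\<not> b" "Suc i"] by (cases "even i") auto
    then have "vtx n b i \<in> S \<longleftrightarrow> vtx n b 0 \<in> S" for i by (induction i) auto
    then show "(\<forall>s i. vtx n s i \<in> S) \<or> (\<forall>s i. vtx n s i \<notin> S)" using same by blast
  qed
  ultimately show ?thesis unfolding ham_matchings_def perfect_matching_prism_iff[OF n] by blast
qed

lemma subset_prism_eqI:
  assumes "M \<subseteq> edges (prism n)" "N \<subseteq> edges (prism n)"
    and "\<And>i. rung n i \<in> M \<longleftrightarrow> rung n i \<in> N" "\<And>s i. rail n s i \<in> M \<longleftrightarrow> rail n s i \<in> N"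
  shows "M = N"
  using assms unfolding edges_prism by blast

text \<open>The properties of a matching are stated at \<open>Suc i\<close>; by periodicity this
  reaches all rungs.\<close>

lemma rung_SucI: "0 < n \<Longrightarrow> (\<And>i. P (rung n (Suc i))) \<Longrightarrow> P (rung n i)"
proof -
  assume n: "0 < n" and P: "\<And>i. P (rung n (Suc i))"
  have "rung n i = rung n (Suc (i + n - 1))" using n by (simp add: rung_eq_iff)
  then show "P (rung n i)" using P by simp
qed

text \<open>Whether a matching contains the rails at \<open>i\<close> of both polygons, of one of
  them, or of none determines to a large extent what happens at \<open>i + 1\<close>: if the
  two polygons agree at one position, they agree everywhere. In this case, with no pair of
  rails in the matching the complement consists of the two polygons; with two pairs in the
  matching, the complement falls apart between them. If the polygons disagree everywhere,
  there is no rung in the matching and the rails alternate.\<close>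

lemma ham_matching_prism_cases:
  assumes n: "3 \<le> n" and M: "M \<in> ham_matchings (prism n)"
  shows "(\<exists>j<n. M = one_gap n j) \<or> (even n \<and> (\<exists>b. M = zigzag n b))"
proof -
  have n0: "0 < n" using n by simp
  have sub: "M \<subseteq> edges (prism n)"
    and one: "\<And>s i. exactly_one (rung n (Suc i) \<in> M) (rail n s i \<in> M) (rail n s (Suc i) \<in> M)"
    and con: "\<And>S. \<lbrakk>\<And>s i. rail n s i \<notin> M \<Longrightarrow> vtx n s i \<in> S \<longleftrightarrow> vtx n s (Suc i) \<in> S;
         \<And>i. rung n i \<notin> M \<Longrightarrow> vtx n False i \<in> S \<longleftrightarrow> vtx n True i \<in> S\<rbrakk> \<Longrightarrow>
         (\<forall>s i. vtx n s i \<in> S) \<or> (\<forall>s i. vtx n s i \<notin> S)"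
    using M unfolding ham_matchings_def perfect_matching_prism_iff[OF n] connects_prism_iff[OF n0] by auto
  define A where "A s i \<longleftrightarrow> rail n s i \<in> M" for s i
  have per: "A s i = A s j" if "i mod n = j mod n" for s i j
    using that rail_eq_iff[OF n, of s i s j] by (simp add: A_def)
  have next_sync: "A True (Suc i) = A False (Suc i) \<longleftrightarrow> A True i = A False i" for i
    using one[of i True] one[of i False] unfolding exactly_one_def A_def by blast
  have sync: "A True i = A False i \<longleftrightarrow> A True 0 = A False 0" for i
    by (induction i) (use next_sync in auto)
  show ?thesis
  proof (cases "A True 0 = A False 0")
    case True
    then have same: "A s i = A False i" for s i using sync[of i] by (cases s) auto
    have rung: "rung n (Suc i) \<in> M \<longleftrightarrow> \<not> A False i \<and> \<not> A False (Suc i)" for i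
      using one[of i False] unfolding exactly_one_def A_def by blast
    have "\<exists>j. A False j"
    proof (rule ccontr)
      assume none: "\<nexists>j. A False j"
      have all: "rung n i \<in> M" for i
        by (rule rung_SucI[OF n0, of "\<lambda>e. e \<in> M"]) (use none rung in simp)
      have "(\<forall>s i. vtx n s i \<in> range (vtx n False)) \<or> (\<forall>s i. vtx n s i \<notin> range (vtx n False))"
      proof (rule con)
        fix s i assume "rail n s i \<notin> M"
        show "vtx n s i \<in> range (vtx n False) \<longleftrightarrow> vtx n s (Suc i) \<in> range (vtx n False)"
          by auto
      qed (use all in blast)
      moreover have "vtx n True 0 \<notin> range (vtx n False)" by auto
      ultimately show False by blast
    qed
    then obtain j0 where "A False j0" ..
    define j where "j = j0 mod n"
    have j: "j < n" "A False j" using \<open>A False j0\<close> n0 per[of j0 j] by (simp_all add: j_def)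
    have no_two: False if ik: "i < k" "k < n" "A False i" "A False k" for i k
    proof -
      \<comment> \<open>The part of the prism between the two gaps.\<close>
      define S where "S = {v. \<exists>s l. v = vtx n s l \<and> i < l mod n \<and> l mod n \<le> k}"
      have S: "vtx n s l \<in> S \<longleftrightarrow> i < l mod n \<and> l mod n \<le> k" for s l
        by (auto simp: S_def)
      have "(\<forall>s l. vtx n s l \<in> S) \<or> (\<forall>s l. vtx n s l \<notin> S)"
      proof (rule con)
        fix s l assume "rail n s l \<notin> M"
        then have "\<not> A False (l mod n)" using same[of s l] per[of l "l mod n"] by (simp add: A_def)
        then have "l mod n \<noteq> i" "l mod n \<noteq> k" using ik by auto
        then show "vtx n s l \<in> S \<longleftrightarrow> vtx n s (Suc l) \<in> S"
          unfolding S mod_Suc using ik by auto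
      qed (simp add: S)
      moreover have "vtx n False k \<in> S" "vtx n False i \<notin> S" using ik by (auto simp: S)
      ultimately show False by blast
    qed
    have A: "A s i \<longleftrightarrow> i mod n = j mod n" for s i
    proof
      assume "A s i"
      then have "A False (i mod n)" using same[of s i] per[of i "i mod n"] by simp
      then show "i mod n = j mod n"
        using no_two[of "i mod n" j] no_two[of j "i mod n"] j n0 by (cases "i mod n" j rule: linorder_cases) auto
    next
      assume "i mod n = j mod n"
      then show "A s i" using per[of i j] j same[of s i] by simp
    qed
    have "M = one_gap n j"
    proof (rule subset_prism_eqI[OF sub])
      show "one_gap n j \<subseteq> edges (prism n)" by (auto simp: one_gap_def)
      show "rail n s i \<in> M \<longleftrightarrow> rail n s i \<in> one_gap n j" for s i
        using A[of s i] by (simp add: rail_in_one_gap_iff[OF n] A_def)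
      show "rung n i \<in> M \<longleftrightarrow> rung n i \<in> one_gap n j" for i
        by (rule rung_SucI[OF n0, of "\<lambda>e. e \<in> M \<longleftrightarrow> e \<in> one_gap n j"])
          (auto simp: rung A rung_in_one_gap_iff Suc_mod_eq_iff)
    qed
    then show ?thesis using j by blast
  next
    case False
    then have anti: "A True i \<longleftrightarrow> \<not> A False i" for i using sync[of i] by blast
    have no_rung_Suc: "rung n (Suc i) \<notin> M" for i
      using one[of i True] one[of i False] anti[of i] unfolding exactly_one_def A_def by blast
    have no_rung: "rung n i \<notin> M" for i
      by (rule rung_SucI[OF n0, of "\<lambda>e. e \<notin> M"]) (rule no_rung_Suc)
    have flip: "A False (Suc i) \<longleftrightarrow> \<not> A False i" for i
      using one[of i False] no_rung_Suc[of i] unfolding exactly_one_def A_def by blast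
    have alt: "A False i \<longleftrightarrow> (even i \<longleftrightarrow> A False 0)" for i
      by (induction i) (use flip in auto)
    have ev: "even n" using alt[of n] per[of n 0 False] by auto
    have "M = zigzag n (\<not> A False 0)"
    proof (rule subset_prism_eqI[OF sub])
      show "zigzag n (\<not> A False 0) \<subseteq> edges (prism n)" by (auto simp: zigzag_def)
      show "rail n s i \<in> M \<longleftrightarrow> rail n s i \<in> zigzag n (\<not> A False 0)" for s i
        unfolding rail_in_zigzag_iff[OF n ev] using alt[of i] anti[of i]
        by (cases s) (auto simp flip: A_def)
      show "rung n i \<in> M \<longleftrightarrow> rung n i \<in> zigzag n (\<not> A False 0)" for i
        using no_rung rung_notin_zigzag by simp
    qed
    then show ?thesis using ev by blast
  qed
qed

theorem card_hamiltonian_cycles_prism: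
  assumes n: "3 \<le> n"
  shows "card (hamiltonian_cycles (prism n)) = n + (if even n then 2 else 0)"
proof -
  have n0: "0 < n" using n by simp
  let ?Z = "if even n then {zigzag n True, zigzag n False} else {}"
  have H: "ham_matchings (prism n) = one_gap n ` {..<n} \<union> ?Z"
  proof (intro equalityI subsetI)
    fix M assume "M \<in> ham_matchings (prism n)"
    from ham_matching_prism_cases[OF n this]
    show "M \<in> one_gap n ` {..<n} \<union> ?Z"
    proof (elim disjE exE conjE)
      fix b assume "even n" "M = zigzag n b"
      then show ?thesis by (cases b) auto
    qed auto
  next
    fix M assume "M \<in> one_gap n ` {..<n} \<union> ?Z"
    then show "M \<in> ham_matchings (prism n)"
      using one_gap_ham[OF n] zigzag_ham[OF n] by (auto split: if_splits)
  qed
  have "inj_on (one_gap n) {..<n}"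
  proof (rule inj_onI)
    fix i j assume ij: "i \<in> {..<n}" "j \<in> {..<n}" and eq: "one_gap n i = one_gap n j"
    have "rail n False i \<in> one_gap n j" unfolding eq[symmetric] by (simp add: rail_in_one_gap_iff[OF n])
    then show "i = j" using ij by (simp add: rail_in_one_gap_iff[OF n])
  qed
  then have c1: "card (one_gap n ` {..<n}) = n" by (simp add: card_image)
  have "one_gap n j \<noteq> zigzag n b" if "even n" for j b
    using rail_in_one_gap_iff[OF n, of "\<not> b" j j] rail_in_one_gap_iff[OF n, of b j j]
      rail_in_zigzag_iff[OF n that, of b j b] rail_in_zigzag_iff[OF n that, of "\<not> b" j b] by auto
  then have disj: "one_gap n ` {..<n} \<inter> ?Z = {}" by auto
  have "zigzag n True \<noteq> zigzag n False" if "even n"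
    using rail_in_zigzag_iff[OF n that, of True 0 True] rail_in_zigzag_iff[OF n that, of True 0 False] by auto
  then have c2: "card ?Z = (if even n then 2 else 0)" by simp
  have "card (ham_matchings (prism n)) = n + (if even n then 2 else 0)"
    unfolding H using disj c1 c2 by (subst card_Un_disjoint) auto
  then show ?thesis
    using card_hamiltonian_cycles[OF simple_graph_prism cubic_prism[OF n]] n by simp
qed

section \<open>Drawings of prisms\<close>

text \<open>The two polygons are drawn on the parabolas \<open>1 + x\<^sup>2\<close> and \<open>- (1 +
  x\<^sup>2)\<close>, so that each of them is convex and the chord that closes it stays on
  its own side of the real axis.\<close>

definition prism_point :: "bool \<Rightarrow> nat \<Rightarrow> complex" where
  "prism_point s i = Complex (real i) ((if s then -1 else 1) * (1 + (real i)\<^sup>2))"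

definition prism_position :: "nat \<Rightarrow> complex" where
  "prism_position v = prism_point (odd v) (v div 2)"

lemma prism_position_vtx: "i < n \<Longrightarrow> prism_position (vtx n s i) = prism_point s i"
  by (simp add: prism_position_def vtx_def)

lemma orient_same_side:
  "orient (prism_point s i) (prism_point s j) (prism_point s k) =
     (if s then -1 else 1) * ((real j - real i) * (real k - real i) * (real k - real j))"
  by (simp add: orient_def prism_point_def power2_eq_square algebra_simps)

lemma orient_rung:
  "orient (prism_point s k) (prism_point (\<not> s) k) (prism_point t i) =
     (if s then -1 else 1) * (2 * (1 + (real k)\<^sup>2) * (real i - real k))"
  by (simp add: orient_def prism_point_def power2_eq_square algebra_simps)

lemma orient_rung_upwards:
  "orient (prism_point False k) (prism_point True k) (prism_point t i) =
     (2 * (1 + (real k)\<^sup>2)) * (real i - real k)"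
  by (simp add: orient_def prism_point_def power2_eq_square algebra_simps)

lemma orient_opposite_side:
  "orient (prism_point s 0) (prism_point s m) (prism_point (\<not> s) k) =
     - (if s then -1 else 1) * (real m * (2 + (real k)\<^sup>2 + real m * real k))"
  by (simp add: orient_def prism_point_def power2_eq_square algebra_simps)

text \<open>The last case is the chord that closes the polygon.\<close>

lemma prism_edge_cases:
  assumes n: "3 \<le> n" and e: "e \<in> edges (prism n)"
  obtains i where "i < n" "e = rung n i"
    | s i where "Suc i < n" "e = {vtx n s i, vtx n s (Suc i)}"
    | s where "e = {vtx n s 0, vtx n s (n - 1)}"
proof -
  from e consider j where "e = rung n j" | s j where "e = rail n s j" by (auto simp: edges_prism)
  then show ?thesis
  proof cases
    case (1 j)
    then have "e = rung n (j mod n)" by (simp add: rung_eq_iff)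
    then show ?thesis using that(1)[of "j mod n"] n by simp
  next
    case (2 s j)
    have rail: "e = rail n s (j mod n)" using 2 by (simp add: rail_eq_iff[OF n])
    have "j mod n < n" using n by simp
    show ?thesis
    proof (cases "Suc (j mod n) < n")
      case True
      then show ?thesis using that(2)[of "j mod n" s] rail by (simp add: rail_def)
    next
      case False
      then have "j mod n = n - 1" using \<open>j mod n < n\<close> by linarith
      moreover have "vtx n s (Suc (n - 1)) = vtx n s 0" using n by simp
      ultimately have "e = {vtx n s 0, vtx n s (n - 1)}"
        unfolding rail rail_def by (simp only: insert_commute)
      then show ?thesis by (rule that(3))
    qed
  qed
qed

lemma cross_free_rungs:
  assumes "i < n" "j < n" "i \<noteq> j"
  shows "cross_free prism_position (rung n i) (rung n j)"
  unfolding rung_def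
proof (rule cross_free_disjoint)
  have "0 < 1 + (real i)\<^sup>2" by (simp add: add_pos_nonneg)
  then have "(2 * (1 + (real i)\<^sup>2)) * (real j - real i) \<noteq> 0" using assms by simp
  then have "0 < ((2 * (1 + (real i)\<^sup>2)) * (real j - real i)) * ((2 * (1 + (real i)\<^sup>2)) * (real j - real i))"
    by (metis not_real_square_gt_zero)
  then show "0 < orient (prism_position (vtx n False i)) (prism_position (vtx n True i)) (prism_position (vtx n False j)) *
      orient (prism_position (vtx n False i)) (prism_position (vtx n True i)) (prism_position (vtx n True j))"
    using assms by (simp only: prism_position_vtx orient_rung_upwards)
qed

lemma cross_free_rung_adjacent:
  assumes "k < n" "l < n" "k \<noteq> l"
  shows "cross_free prism_position (rung n k) {vtx n s k, vtx n s l}"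
proof -
  have "orient (prism_point s k) (prism_point (\<not> s) k) (prism_point s l) \<noteq> 0"
    using assms by (simp add: orient_rung add_pos_nonneg less_imp_neq[symmetric] add_nonneg_eq_0_iff)
  then have "cross_free prism_position {vtx n s k, vtx n (\<not> s) k} {vtx n s k, vtx n s l}"
    using assms by (intro cross_free_adjacent) (simp add: prism_position_vtx)
  moreover have "rung n k = {vtx n s k, vtx n (\<not> s) k}" by (cases s) (auto simp: rung_def)
  ultimately show ?thesis by simp
qed

lemma cross_free_rung_rail:
  assumes "k < n" "Suc i < n"
  shows "cross_free prism_position (rung n k) {vtx n s i, vtx n s (Suc i)}"
proof (cases "k = i \<or> k = Suc i")
  case True
  then show ?thesis
    using cross_free_rung_adjacent[of k n "Suc i" s] cross_free_rung_adjacent[of k n i s] assms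
    by (auto simp: insert_commute)
next
  case False
  have "0 < (2 * (1 + (real k)\<^sup>2)) * (2 * (1 + (real k)\<^sup>2)) * ((real i - real k) * (real (Suc i) - real k))"
  proof (rule mult_pos_pos)
    show "0 < (real i - real k) * (real (Suc i) - real k)"
      using False by (cases "i < k") (auto intro: mult_pos_pos mult_neg_neg)
  qed (simp add: add_pos_nonneg)
  moreover have "\<dots> = ((2 * (1 + (real k)\<^sup>2)) * (real i - real k)) * ((2 * (1 + (real k)\<^sup>2)) * (real (Suc i) - real k))"
    by (simp only: mult_ac)
  ultimately show ?thesis
    unfolding rung_def using assms
    by (intro cross_free_disjoint) (simp only: prism_position_vtx orient_rung_upwards Suc_lessD)
qed

lemma cross_free_rung_chord:
  assumes n: "3 \<le> n" and k: "k < n"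
  shows "cross_free prism_position (rung n k) {vtx n s 0, vtx n s (n - 1)}"
proof (cases "k = 0 \<or> k = n - 1")
  case True
  then show ?thesis
    using cross_free_rung_adjacent[of 0 n "n - 1" s] cross_free_rung_adjacent[of "n - 1" n 0 s] n
    by (auto simp: insert_commute)
next
  case False
  define m where "m = n - 1"
  have km: "0 < real k" "real k < real m" using False k by (auto simp: m_def)
  let ?o = "\<lambda>t. orient (prism_point s 0) (prism_point s m) (prism_point t k)"
  have "?o s * ?o (\<not> s) = (real m * real k * (real m - real k)) * (real m * (2 + (real k)\<^sup>2 + real m * real k))"
    unfolding orient_same_side orient_opposite_side by (simp add: algebra_simps)
  moreover have "0 < \<dots>"
    using km by (intro mult_pos_pos add_pos_pos) auto
  ultimately have "0 < ?o s * ?o (\<not> s)" by simp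
  then have "cross_free prism_position {vtx n s 0, vtx n s m} {vtx n s k, vtx n (\<not> s) k}"
    using n k by (intro cross_free_disjoint) (simp add: prism_position_vtx m_def)
  moreover have "rung n k = {vtx n s k, vtx n (\<not> s) k}" by (cases s) (auto simp: rung_def)
  ultimately show ?thesis by (simp add: m_def cross_free_sym)
qed

lemma cross_free_same_side:
  assumes i: "Suc i < n" and k: "k < n" "l < n" "k \<noteq> l" and ne: "{k, l} \<noteq> {i, Suc i}"
  shows "cross_free prism_position {vtx n s i, vtx n s (Suc i)} {vtx n s k, vtx n s l}"
proof -
  have adj: "cross_free prism_position {vtx n s a, vtx n s b} {vtx n s a, vtx n s c}"
    if "a < n" "b < n" "c < n" "a \<noteq> b" "a \<noteq> c" "b \<noteq> c" for a b c
    using that by (intro cross_free_adjacent) (simp add: prism_position_vtx orient_same_side)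
  show ?thesis
  proof (cases "{k, l} \<inter> {i, Suc i} = {}")
    case True
    have pos: "0 < (real x - real i) * (real x - real (Suc i))" if "x \<noteq> i" "x \<noteq> Suc i" for x
      using that by (cases "x < i") (auto intro: mult_pos_pos mult_neg_neg)
    let ?o = "\<lambda>x. orient (prism_point s i) (prism_point s (Suc i)) (prism_point s x)"
    have "?o k * ?o l = ((real k - real i) * (real k - real (Suc i))) * ((real l - real i) * (real l - real (Suc i)))"
      by (simp add: orient_same_side)
    also have "0 < \<dots>" using True by (intro mult_pos_pos[OF pos pos]) auto
    finally show ?thesis using i k by (intro cross_free_disjoint) (simp add: prism_position_vtx)
  next
    case False
    then consider "k = i" "l \<noteq> Suc i" | "k = Suc i" "l \<noteq> i" | "l = i" "k \<noteq> Suc i" | "l = Suc i" "k \<noteq> i"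
      using ne unfolding doubleton_eq_iff by blast
    then show ?thesis
    proof cases
      case 1 then show ?thesis using adj[of i "Suc i" l] i k by simp
    next
      case 2 then show ?thesis using adj[of "Suc i" i l] i k by (simp add: insert_commute)
    next
      case 3 then show ?thesis using adj[of i "Suc i" k] i k by (simp add: insert_commute)
    next
      case 4 then show ?thesis using adj[of "Suc i" i k] i k by (simp add: insert_commute)
    qed
  qed
qed

lemma cross_free_opposite_sides:
  assumes "i < n" "j < n" "k < n" "l < n"
  shows "cross_free prism_position {vtx n s i, vtx n s j} {vtx n (\<not> s) k, vtx n (\<not> s) l}"
proof -
  have up: "cross_free prism_position {vtx n False i, vtx n False j} {vtx n True k, vtx n True l}"
    if "i < n" "j < n" "k < n" "l < n" for i j k l
  proof -
    have pos: "0 < 1 + x * x" "- 1 \<le> x * x" for x :: real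
      by (simp add: add_pos_nonneg) (use zero_le_square[of x] in linarith)
    have "convex hull {prism_point False i, prism_point False j} \<inter>
        convex hull {prism_point True k, prism_point True l} = {}"
      by (rule disjoint_hulls_of_halfspaces[where w = \<i> and t = 0])
        (use pos in \<open>auto simp: prism_point_def inner_complex_def power2_eq_square less_imp_le\<close>)
    then show ?thesis using that by (simp add: cross_free_def prism_position_vtx)
  qed
  show ?thesis
    using up[of i j k l] up[of k l i j] assms by (cases s) (simp_all add: cross_free_sym)
qed

lemma planar_prism:
  assumes n: "3 \<le> n"
  shows "planar (prism n)"
proof (rule planar_straight_line)
  show "simple_graph (prism n)" using n by (intro simple_graph_prism) simp
  show "cubic (prism n)" using n by (rule cubic_prism)
  show "inj_on prism_position (verts (prism n))"
  proof (rule inj_onI)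
    fix v w assume vw: "prism_position v = prism_position w"
    then have d: "v div 2 = w div 2" by (simp add: prism_position_def prism_point_def)
    have "0 < 1 + (real (w div 2))\<^sup>2" by (simp add: add_pos_nonneg)
    then have "odd v = odd w"
      using vw d by (auto simp: prism_position_def prism_point_def split: if_splits)
    then show "v = w" using d by (metis dvd_mult_div_cancel odd_two_times_div_two_succ)
  qed
  fix e f assume ef: "e \<in> edges (prism n)" "f \<in> edges (prism n)" "e \<noteq> f"
  have rung: "cross_free prism_position (rung n k) f" if "k < n" "f \<in> edges (prism n)" "rung n k \<noteq> f" for k f
    using prism_edge_cases[OF n that(2)]
  proof cases
    case (1 j)
    then show ?thesis using cross_free_rungs that by blast
  qed (use that n cross_free_rung_rail cross_free_rung_chord in auto)
  have n1: "n - 1 < n" "0 < n" "0 \<noteq> n - 1" using n by auto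
  have rail: "cross_free prism_position {vtx n s i, vtx n s (Suc i)} f"
    if i: "Suc i < n" and f: "f \<in> edges (prism n)" "f \<noteq> {vtx n s i, vtx n s (Suc i)}" for s i f
    using prism_edge_cases[OF n f(1)]
  proof cases
    case (1 j)
    then show ?thesis using cross_free_rung_rail[of j n i s] i by (simp add: cross_free_sym)
  next
    case (2 t j)
    show ?thesis
    proof (cases "t = s")
      case True
      have "i \<noteq> j" using f(2) 2 True by auto
      then have "{j, Suc j} \<noteq> {i, Suc i}" by (auto simp: doubleton_eq_iff)
      then show ?thesis using cross_free_same_side[of i n j "Suc j" s] i 2 True by simp
    next
      case False
      then have "t = (\<not> s)" by simp
      then show ?thesis using cross_free_opposite_sides[of i n "Suc i" j "Suc j" s] i 2 by simp
    qed
  next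
    case (3 t)
    show ?thesis
    proof (cases "t = s")
      case True
      have "{0, n - 1} \<noteq> {i, Suc i}" using n by (auto simp: doubleton_eq_iff)
      then show ?thesis using cross_free_same_side[of i n 0 "n - 1" s] i 3 True n1 by simp
    next
      case False
      then have "t = (\<not> s)" by simp
      then show ?thesis using cross_free_opposite_sides[of i n "Suc i" 0 "n - 1" s] i 3 n1 by simp
    qed
  qed
  show "cross_free prism_position e f"
    using prism_edge_cases[OF n ef(1)]
  proof cases
    case (1 k)
    then show ?thesis using rung ef by simp
  next
    case (2 s i)
    then show ?thesis using rail ef by auto
  next
    case e: (3 s)
    from prism_edge_cases[OF n ef(2)] show ?thesis
    proof cases
      case (1 k)
      then show ?thesis using rung[of k e] ef by (simp add: cross_free_sym)
    next
      case (2 t i)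
      then have "cross_free prism_position f e" using rail[of i e t] ef by simp
      then show ?thesis by (simp add: cross_free_sym)
    next
      case (3 t)
      then have "t = (\<not> s)" using e ef by auto
      then show ?thesis using cross_free_opposite_sides[of 0 n "n - 1" 0 "n - 1" s] e 3 n1 by simp
    qed
  qed
qed

section \<open>Inserting an edge\<close>

definition insert_edge :: "'a \<Rightarrow> 'a \<Rightarrow> 'a \<Rightarrow> 'a \<Rightarrow> 'a \<Rightarrow> 'a \<Rightarrow> 'a sgraph \<Rightarrow> 'a sgraph" where
  "insert_edge a b c d u v G = (insert u (insert v (verts G)),
     (edges G - {{a, b}, {c, d}}) \<union> {{a, u}, {b, u}, {c, v}, {d, v}, {u, v}})"

definition robust :: "'a sgraph \<Rightarrow> bool" where
  "robust G \<longleftrightarrow> simple_graph G \<and> cubic G \<and> four_cuts G"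

text \<open>Count the pairs of a vertex in \<open>T\<close> and an edge at this vertex.\<close>

lemma cut_subset_bound:
  assumes simple: "simple_graph G" and cubic: "cubic G" and T: "T \<subseteq> verts G"
  shows "3 * card T \<le> card (cut G T) + 2 * card {e \<in> edges G. e \<subseteq> T}"
proof -
  have E: "\<And>e. e \<in> edges G \<Longrightarrow> e \<subseteq> verts G \<and> card e = 2" and fin: "finite (verts G)"
    using simple by (auto simp: simple_graph_def)
  have finE: "finite (edges G)" using E fin by (intro finite_subset[of "edges G" "Pow (verts G)"]) auto
  have finT: "finite T" using T fin finite_subset by blast
  have "3 * card T = (\<Sum>v\<in>T. card {e \<in> edges G. v \<in> e})"
    using cubic T by (simp add: cubic_def subset_iff)
  also have "\<dots> = (\<Sum>v\<in>T. \<Sum>e\<in>edges G. if v \<in> e then 1 else 0)"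
    using finE by (intro sum.cong refl) (simp add: sum.If_cases Int_def)
  also have "\<dots> = (\<Sum>e\<in>edges G. \<Sum>v\<in>T. if v \<in> e then 1 else 0)" by (rule sum.swap)
  also have "\<dots> = (\<Sum>e\<in>edges G. card (e \<inter> T))"
    using finT by (intro sum.cong refl) (simp add: sum.If_cases Int_def conj_commute)
  also have "\<dots> \<le> (\<Sum>e\<in>edges G. (if e \<in> cut G T then 1 else 0) + 2 * (if e \<subseteq> T then 1 else 0))"
  proof (rule sum_mono)
    fix e assume e: "e \<in> edges G"
    have fe: "finite e" "card e = 2" using E[OF e] card_ge_0_finite[of e] by simp_all
    show "card (e \<inter> T) \<le> (if e \<in> cut G T then 1 else 0) + 2 * (if e \<subseteq> T then 1 else 0)"
    proof (cases "e \<subseteq> T")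
      case True
      then show ?thesis using fe by (simp add: Int_absorb2)
    next
      case False
      then have "card (e \<inter> T) < card e" using fe by (intro psubset_card_mono) auto
      moreover have "card (e \<inter> T) = 0" if "e \<notin> cut G T" using that False e by (auto simp: cut_def)
      ultimately show ?thesis using fe by auto
    qed
  qed
  also have "\<dots> = card (cut G T) + 2 * card {e \<in> edges G. e \<subseteq> T}"
  proof -
    have "edges G \<inter> {e. e \<in> cut G T} = cut G T" by (auto simp: cut_def)
    then show ?thesis using finE
      by (simp add: sum.distrib sum.If_cases sum_distrib_left[symmetric] Int_def)
  qed
  finally show ?thesis .
qed

lemma edges_at_exchange:
  assumes "{e \<in> X. x \<in> e} = {f}" "{e \<in> Y. x \<in> e} = {g}"
  shows "{e \<in> (F - X) \<union> Y. x \<in> e} = insert g ({e \<in> F. x \<in> e} - {f})"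
  using assms by blast

text \<open>\<open>u\<close> and \<open>v\<close> subdivide the disjoint edges \<open>{a, b}\<close> and
  \<open>{c, d}\<close> and are joined by a new edge.\<close>

locale edge_insertion =
  fixes G :: "'a sgraph" and a b c d u v :: 'a
  assumes robust: "robust G"
    and ab: "{a, b} \<in> edges G" and cd: "{c, d} \<in> edges G"
    and disjoint: "{a, b} \<inter> {c, d} = {}"
    and new: "u \<notin> verts G" "v \<notin> verts G" "u \<noteq> v"
begin

definition H :: "'a sgraph" where "H = insert_edge a b c d u v G"

lemma simple: "simple_graph G" and cubic: "cubic G" and cuts: "four_cuts G"
  using robust by (simp_all add: robust_def)

lemma E: "e \<in> edges G \<Longrightarrow> e \<subseteq> verts G \<and> card e = 2"
  using simple by (auto simp: simple_graph_def)

lemma fin: "finite (verts G)"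
  using simple by (auto simp: simple_graph_def)

lemma old: "a \<in> verts G" "b \<in> verts G" "c \<in> verts G" "d \<in> verts G" "a \<noteq> b" "c \<noteq> d"
  using E[OF ab] E[OF cd] by auto

lemma diff: "a \<noteq> c" "a \<noteq> d" "b \<noteq> c" "b \<noteq> d" "a \<noteq> u" "b \<noteq> u" "c \<noteq> u" "d \<noteq> u" "a \<noteq> v" "b \<noteq> v" "c \<noteq> v" "d \<noteq> v"
  using disjoint old new by auto

lemma verts_H: "verts H = insert u (insert v (verts G))"
  and edges_H: "edges H = (edges G - {{a, b}, {c, d}}) \<union> {{a, u}, {b, u}, {c, v}, {d, v}, {u, v}}"
  by (simp_all add: H_def insert_edge_def)

lemma simple_H: "simple_graph H"
  unfolding simple_graph_def verts_H edges_H
  using E fin old diff new by (auto simp: card_insert_if)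

lemma new_notin: "e \<in> edges G \<Longrightarrow> u \<notin> e \<and> v \<notin> e"
  using E new by blast

lemma degree_end:
  assumes "x \<in> verts G" "f \<in> edges G" "x \<in> f" "u \<in> g \<or> v \<in> g"
    and f: "{e \<in> {{a, b}, {c, d}}. x \<in> e} = {f}"
    and g: "{e \<in> {{a, u}, {b, u}, {c, v}, {d, v}, {u, v}}. x \<in> e} = {g}"
  shows "card {e \<in> edges H. x \<in> e} = 3"
proof -
  have H: "{e \<in> edges H. x \<in> e} = insert g ({e \<in> edges G. x \<in> e} - {f})"
    unfolding edges_H using f g by (rule edges_at_exchange)
  have c: "card {e \<in> edges G. x \<in> e} = 3" using cubic assms(1) by (simp add: cubic_def)
  then have fin: "finite {e \<in> edges G. x \<in> e}" by (intro card_ge_0_finite) simp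
  have "g \<notin> {e \<in> edges G. x \<in> e} - {f}" using new_notin assms(4) by blast
  then have "card {e \<in> edges H. x \<in> e} = Suc (card ({e \<in> edges G. x \<in> e} - {f}))"
    unfolding H using fin by (intro card_insert_disjoint) auto
  then show ?thesis using c assms(2,3) by simp
qed

lemma cubic_H: "cubic H"
  unfolding cubic_def
proof
  fix x assume "x \<in> verts H"
  then consider "x = u" | "x = v" | "x = a" | "x = b" | "x = c" | "x = d"
    | "x \<in> verts G" "x \<notin> {a, b, c, d}" unfolding verts_H by blast
  then show "card {e \<in> edges H. x \<in> e} = 3"
  proof cases
    case 1
    then have "{e \<in> edges H. x \<in> e} = {{a, u}, {b, u}, {u, v}}"
      unfolding edges_H using diff new by (auto dest: new_notin)
    then show ?thesis using old diff new by (simp add: card_insert_if doubleton_eq_iff)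
  next
    case 2
    then have "{e \<in> edges H. x \<in> e} = {{c, v}, {d, v}, {u, v}}"
      unfolding edges_H using diff new by (auto dest: new_notin)
    then show ?thesis using old diff new by (simp add: card_insert_if doubleton_eq_iff)
  next
    case 3
    then show ?thesis
      using degree_end[of a "{a, b}" "{a, u}"] old ab diff by (simp add: Collect_conv_if conj_disj_distribR Collect_disj_eq)
  next
    case 4
    then show ?thesis
      using degree_end[of b "{a, b}" "{b, u}"] old ab diff by (simp add: Collect_conv_if conj_disj_distribR Collect_disj_eq)
  next
    case 5
    then show ?thesis
      using degree_end[of c "{c, d}" "{c, v}"] old cd diff by (simp add: Collect_conv_if conj_disj_distribR Collect_disj_eq)
  next
    case 6
    then show ?thesis
      using degree_end[of d "{c, d}" "{d, v}"] old cd diff by (simp add: Collect_conv_if conj_disj_distribR Collect_disj_eq)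
  next
    case 7
    then have "{e \<in> edges H. x \<in> e} = {e \<in> edges G. x \<in> e}"
      unfolding edges_H using new by auto
    then show ?thesis using cubic 7 by (simp add: cubic_def)
  qed
qed

lemma finite_edges_H: "finite (edges H)"
  using simple_H by (intro finite_subset[of "edges H" "Pow (verts H)"]) (auto simp: simple_graph_def)

lemma finite_cut: "finite (cut H S)"
  using finite_edges_H by (rule finite_subset[rotated]) (auto simp: cut_def)

text \<open>Every edge of the old cut survives, or one of the two halves into which it has been
  subdivided belongs to the new cut.\<close>

lemma cut_H_ge_old:
  "card (cut G (S \<inter> verts G)) \<le> card (cut H S)"
proof -
  define \<phi> where "\<phi> e = (if e = {a, b} then if a \<in> S \<longleftrightarrow> u \<in> S then {b, u} else {a, u}
      else if e = {c, d} then if c \<in> S \<longleftrightarrow> v \<in> S then {d, v} else {c, v} else e)" for e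
  have "inj_on \<phi> (cut G (S \<inter> verts G))"
  proof (rule inj_onI)
    fix e f assume ef: "e \<in> cut G (S \<inter> verts G)" "f \<in> cut G (S \<inter> verts G)" "\<phi> e = \<phi> f"
    have "u \<notin> e" "v \<notin> e" "u \<notin> f" "v \<notin> f" using ef new_notin by (auto simp: cut_def)
    moreover have "u \<in> \<phi> g" if "g = {a, b}" for g using that by (simp add: \<phi>_def)
    moreover have "v \<in> \<phi> g \<and> u \<notin> \<phi> g" if "g = {c, d}" for g
      using that disjoint diff new by (auto simp: \<phi>_def)
    moreover have "\<phi> g = g" if "g \<noteq> {a, b}" "g \<noteq> {c, d}" for g using that by (simp add: \<phi>_def)
    ultimately show "e = f" using ef(3) by metis
  qed
  moreover have "\<phi> e \<in> cut H S" if "e \<in> cut G (S \<inter> verts G)" for e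
  proof -
    have e: "e \<in> edges G" "e \<inter> S \<noteq> {}" "\<not> e \<subseteq> S" using that E by (auto simp: cut_def)
    consider "e = {a, b}" | "e = {c, d}" | "e \<noteq> {a, b}" "e \<noteq> {c, d}" by blast
    then show ?thesis
    proof cases
      case 1
      then have "a \<in> S \<longleftrightarrow> b \<notin> S" using e by auto
      then show ?thesis using 1 by (auto simp: \<phi>_def cut_def edges_H)
    next
      case 2
      then have "c \<in> S \<longleftrightarrow> d \<notin> S" "e \<noteq> {a, b}" using e disjoint by auto
      then show ?thesis using 2 by (auto simp: \<phi>_def cut_def edges_H)
    next
      case 3
      then show ?thesis using e by (auto simp: \<phi>_def cut_def edges_H)
    qed
  qed
  then have "\<phi> ` cut G (S \<inter> verts G) \<subseteq> cut H S" by blast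
  ultimately show ?thesis using finite_cut by (rule card_inj_on_le)
qed

text \<open>Besides \<open>u\<close> and \<open>v\<close>, the set \<open>S\<close> contains at most one
  vertex. If it has three elements, they do not form a triangle, because the two
  subdivided edges are disjoint.\<close>

lemma cut_H_small:
  assumes S: "S \<subseteq> verts H" "2 \<le> card S" and small: "card (S \<inter> verts G) \<le> 1"
  shows "4 \<le> card (cut H S)"
proof -
  have finS: "finite S" using S(1) simple_H finite_subset by (auto simp: simple_graph_def)
  have EH: "e \<subseteq> verts H \<and> card e = 2" if "e \<in> edges H" for e
    using simple_H that by (auto simp: simple_graph_def)
  have bound: "3 * card S \<le> card (cut H S) + 2 * card {e \<in> edges H. e \<subseteq> S}"
    by (rule cut_subset_bound[OF simple_H cubic_H S(1)])
  show ?thesis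
  proof (cases "card S = 2")
    case True
    have "{e \<in> edges H. e \<subseteq> S} \<subseteq> {S}"
      using EH finS True by (auto dest: card_subset_eq)
    then have "card {e \<in> edges H. e \<subseteq> S} \<le> 1" using card_mono[of "{S}"] by fastforce
    then show ?thesis using bound True by simp
  next
    case False
    have dec: "S = (S \<inter> verts G) \<union> (S \<inter> {u, v})" using S(1) unfolding verts_H by blast
    have "card S \<le> card (S \<inter> verts G) + card (S \<inter> {u, v})"
      by (subst dec) (rule card_Un_le)
    moreover have uv2: "card (S \<inter> {u, v}) \<le> 2"
      using card_mono[of "{u, v}" "S \<inter> {u, v}"] new by simp
    ultimately have c: "card S = 3" "card (S \<inter> verts G) = 1" "card (S \<inter> {u, v}) = 2"
      using S(2) False small by auto
    then obtain s where s: "S \<inter> verts G = {s}" by (auto simp: card_1_singleton_iff)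
    have "S \<inter> {u, v} = {u, v}"
      using c(3) new by (intro card_subset_eq) auto
    then have S3: "S = {s, u, v}" "s \<in> verts G" using s dec by auto
    have su: "s \<noteq> u" "s \<noteq> v" using S3 new by auto
    obtain w where w: "w \<in> {u, v}" "{s, w} \<notin> edges H"
    proof -
      have "{s, u} \<in> edges H \<Longrightarrow> s \<in> {a, b}" "{s, v} \<in> edges H \<Longrightarrow> s \<in> {c, d}"
        using su new diff new_notin by (auto simp: edges_H doubleton_eq_iff)
      then show ?thesis using that disjoint by blast
    qed
    have "e = {s, u} \<or> e = {s, v} \<or> e = {u, v}" if e: "e \<in> edges H" "e \<subseteq> S" for e
    proof -
      obtain x y where "e = {x, y}" "x \<noteq> y" using EH[OF e(1)] by (auto simp: card_2_iff)
      then show ?thesis using e(2) S3 by (auto simp: doubleton_eq_iff)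
    qed
    then have "{e \<in> edges H. e \<subseteq> S} \<subseteq> {{s, u}, {s, v}, {u, v}} - {{s, w}}" using w by auto
    then have "card {e \<in> edges H. e \<subseteq> S} \<le> card ({{s, u}, {s, v}, {u, v}} - {{s, w}})"
      by (intro card_mono) auto
    also have "\<dots> = 2" using w su new by (auto simp: card_insert_if doubleton_eq_iff)
    finally show ?thesis using bound c by simp
  qed
qed

text \<open>If the old part of \<open>S\<close> or of its complement has at most one vertex, the cut
  is estimated directly; otherwise the old graph provides enough edges.\<close>

lemma four_cuts_H: "four_cuts H"
  unfolding four_cuts_def
proof (intro allI impI, elim conjE)
  fix S assume S: "S \<subseteq> verts H" "2 \<le> card S" "2 \<le> card (verts H - S)"
  have compl: "cut H (verts H - S) = cut H S"
    using simple_H by (auto simp: cut_def simple_graph_def)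
  have part: "verts G - S \<inter> verts G = (verts H - S) \<inter> verts G" unfolding verts_H by blast
  consider "card (S \<inter> verts G) \<le> 1" | "card ((verts H - S) \<inter> verts G) \<le> 1"
    | "2 \<le> card (S \<inter> verts G)" "2 \<le> card (verts G - S \<inter> verts G)" unfolding part by linarith
  then show "4 \<le> card (cut H S)"
  proof cases
    case 1
    then show ?thesis using cut_H_small S by blast
  next
    case 2
    then show ?thesis using cut_H_small[of "verts H - S"] S compl by auto
  next
    case 3
    then have "4 \<le> card (cut G (S \<inter> verts G))" using cuts unfolding four_cuts_def by blast
    then show ?thesis using cut_H_ge_old[of S] by linarith
  qed
qed

lemma robust_insert_edge: "robust (insert_edge a b c d u v G)"
  using simple_H cubic_H four_cuts_H unfolding robust_def H_def by simp

end

section \<open>Graphs given by lists\<close>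

definition list_graph :: "nat \<Rightarrow> (nat \<times> nat) list \<Rightarrow> nat sgraph" where
  "list_graph n es = ({..<n}, (\<lambda>(x, y). {x, y}) ` set es)"

text \<open>With increasing pairs, edges and pairs correspond bijectively.\<close>

definition ordered_pairs :: "nat \<Rightarrow> (nat \<times> nat) list \<Rightarrow> bool" where
  "ordered_pairs n es \<longleftrightarrow> (\<forall>(x, y)\<in>set es. x < y \<and> y < n)"

text \<open>Each quadruple \<open>(a, b, c, d)\<close> inserts an edge between new vertices
  \<open>n\<close> and \<open>n + 1\<close>, which subdivide \<open>{a, b}\<close> and \<open>{c,
  d}\<close>. The result is \<open>None\<close> if these are not disjoint edges of the graph.\<close>

fun grow :: "nat \<Rightarrow> (nat \<times> nat) list \<Rightarrow> (nat \<times> nat \<times> nat \<times> nat) list \<Rightarrow> (nat \<times> nat) list option" where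
  "grow n es [] = Some es"
| "grow n es ((a, b, c, d) # ops) =
    (if (a, b) \<in> set es \<and> (c, d) \<in> set es \<and> a \<noteq> c \<and> a \<noteq> d \<and> b \<noteq> c \<and> b \<noteq> d
     then grow (n + 2) (removeAll (a, b) (removeAll (c, d) es) @
       [(a, n), (b, n), (c, n + 1), (d, n + 1), (n, n + 1)]) ops
     else None)"

lemma inj_on_unordered:
  "inj_on (\<lambda>(x, y). {x, y}) {(x, y). x < (y :: nat)}"
  by (auto simp: inj_on_def doubleton_eq_iff)

lemma robust_list_graph_grow:
  assumes "robust (list_graph n es)" "ordered_pairs n es" "grow n es ops = Some fs"
  shows "robust (list_graph (n + 2 * length ops) fs) \<and> ordered_pairs (n + 2 * length ops) fs"
  using assms
proof (induction n es ops rule: grow.induct)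
  case (2 n es a b c d ops)
  let ?es = "removeAll (a, b) (removeAll (c, d) es) @
       [(a, n), (b, n), (c, n + 1), (d, n + 1), (n, n + 1)]"
  have op: "(a, b) \<in> set es" "(c, d) \<in> set es" "a \<noteq> c" "a \<noteq> d" "b \<noteq> c" "b \<noteq> d"
    and rest: "grow (n + 2) ?es ops = Some fs"
    using "2.prems"(3) by (auto split: if_splits)
  have lt: "a < b" "b < n" "c < d" "d < n" using op "2.prems"(2) by (auto simp: ordered_pairs_def)
  let ?u = "\<lambda>(x, y). {x, y :: nat}"
  have sub: "set es \<subseteq> {(x, y). x < y}" using "2.prems"(2) by (auto simp: ordered_pairs_def)
  have "?u ` (set es - {(a, b), (c, d)}) = ?u ` set es - ?u ` {(a, b), (c, d)}"
    by (rule inj_on_image_set_diff[OF inj_on_unordered]) (use sub lt in auto)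
  moreover have "set ?es = (set es - {(a, b), (c, d)}) \<union>
      {(a, n), (b, n), (c, n + 1), (d, n + 1), (n, n + 1)}"
    by auto
  ultimately have "?u ` set ?es = (?u ` set es - {{a, b}, {c, d}}) \<union>
      {{a, n}, {b, n}, {c, n + 1}, {d, n + 1}, {n, n + 1}}"
    by (simp only: image_Un image_insert image_empty prod.case)
  then have eq: "list_graph (n + 2) ?es = insert_edge a b c d n (n + 1) (list_graph n es)"
    by (auto simp: list_graph_def insert_edge_def)
  have "edge_insertion (list_graph n es) a b c d n (n + 1)"
  proof
    show "robust (list_graph n es)" by fact
    show "{a, b} \<in> edges (list_graph n es)" "{c, d} \<in> edges (list_graph n es)"
      using op by (force simp: list_graph_def)+
  qed (use op in \<open>auto simp: list_graph_def\<close>)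
  then have "robust (list_graph (n + 2) ?es)" unfolding eq by (rule edge_insertion.robust_insert_edge)
  moreover have "ordered_pairs (n + 2) ?es" using "2.prems"(2) lt by (auto simp: ordered_pairs_def)
  ultimately have "robust (list_graph (n + 2 + 2 * length ops) fs) \<and> ordered_pairs (n + 2 + 2 * length ops) fs"
    by (intro "2.IH"[OF _ _ _ rest]) (use op in simp_all)
  then show ?case by (simp add: algebra_simps)
qed simp

definition cube_pairs :: "(nat \<times> nat) list" where
  "cube_pairs = [(0, 1), (2, 3), (4, 5), (6, 7), (0, 2), (2, 4), (4, 6), (0, 6),
     (1, 3), (3, 5), (5, 7), (1, 7)]"

lemma ordered_pairs_cube: "ordered_pairs 8 cube_pairs"
  by (simp add: ordered_pairs_def cube_pairs_def)

lemma robust_cube: "robust (list_graph 8 cube_pairs)"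
proof -
  have period: "range f = f ` {..<4}" if "\<And>i. f i = f (i mod 4)" for f :: "nat \<Rightarrow> nat set"
    using that by (auto simp: image_iff) (metis lessThan_iff mod_less_divisor zero_less_numeral)
  have 4: "{..<4::nat} = {0, 1, 2, 3}" by auto
  have "range (rung 4) = rung 4 ` {..<4}" by (rule period) (simp add: rung_eq_iff)
  then have "range (rung 4) = {{0, 1}, {2, 3}, {4, 5}, {6, 7}}"
    by (simp add: 4 rung_def vtx_def)
  moreover have rail: "range (rail 4 s) = rail 4 s ` {..<4}" for s by (rule period) (simp add: rail_eq_iff)
  have rails: "rail 4 False 0 = {0, 2}" "rail 4 False 1 = {2, 4}" "rail 4 False 2 = {4, 6}" "rail 4 False 3 = {0, 6}"
    "rail 4 True 0 = {1, 3}" "rail 4 True 1 = {3, 5}" "rail 4 True 2 = {5, 7}" "rail 4 True 3 = {1, 7}"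
    by (auto simp: rail_def vtx_def)
  have "range (rail 4 False) = {{0, 2}, {2, 4}, {4, 6}, {0, 6}}"
    unfolding rail 4 by (simp only: image_insert image_empty rails)
  moreover have "range (rail 4 True) = {{1, 3}, {3, 5}, {5, 7}, {1, 7}}"
    unfolding rail 4 by (simp only: image_insert image_empty rails)
  ultimately have "edges (prism 4) =
      {{0, 1}, {2, 3}, {4, 5}, {6, 7}} \<union> ({{0, 2}, {2, 4}, {4, 6}, {0, 6}} \<union> {{1, 3}, {3, 5}, {5, 7}, {1, 7}})"
    by (simp only: edges_prism UNIV_bool UN_insert UN_empty Un_empty_right)
  then have "prism 4 = list_graph 8 cube_pairs"
    by (simp add: prod_eq_iff list_graph_def cube_pairs_def) (auto simp: prism_def intro!: equalityI)
  then show ?thesis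
    using simple_graph_prism[of 4] cubic_prism[of 4] four_cuts_prism[of 4] by (simp add: robust_def)
qed

section \<open>Counting hamiltonian cycles by vertex elimination\<close>

text \<open>Eliminating a vertex \<open>v\<close> replaces all (hyper)edges at \<open>v\<close> by their
  union without \<open>v\<close>. This does not change connectivity, except that \<open>v\<close> is a component of
  its own if the union is empty and other vertices remain.\<close>

lemma connects_eliminate:
  assumes v: "v \<notin> W" and sub: "\<Union>F \<subseteq> insert v W"
  defines "h \<equiv> \<Union>{e \<in> F. v \<in> e} - {v}"
  shows "connects F (insert v W) \<longleftrightarrow> (h \<noteq> {} \<or> W = {}) \<and> connects (insert h {e \<in> F. v \<notin> e}) W"
proof (cases "h = {} \<and> W \<noteq> {}")
  case True
  then have "\<forall>e\<in>F. e \<subseteq> {v} \<or> e \<inter> {v} = {}" unfolding h_def by blast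
  moreover have "\<not> (insert v W \<subseteq> {v} \<or> insert v W \<inter> {v} = {})" using True v by blast
  ultimately have "\<not> connects F (insert v W)" unfolding connects_def by blast
  then show ?thesis using True by simp
next
  case False
  have hW: "h \<subseteq> W" using sub unfolding h_def by blast
  have "connects (insert h {e \<in> F. v \<notin> e}) W" if con: "connects F (insert v W)"
    unfolding connects_def
  proof (intro allI impI)
    fix S assume cl: "\<forall>e\<in>insert h {e \<in> F. v \<notin> e}. e \<subseteq> S \<or> e \<inter> S = {}"
    \<comment> \<open>The eliminated vertex is placed on the side of \<open>h\<close>.\<close>
    define S' where "S' = (if h \<subseteq> S then insert v S else S - {v})"
    have "e \<subseteq> S' \<or> e \<inter> S' = {}" if e: "e \<in> F" for e
    proof (cases "v \<in> e")
      case True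
      then have "e \<subseteq> insert v h" using e unfolding h_def by blast
      then show ?thesis using cl unfolding S'_def by auto
    next
      case False
      then show ?thesis using cl e unfolding S'_def by auto
    qed
    then have closed: "insert v W \<subseteq> S' \<or> insert v W \<inter> S' = {}"
      using con by (simp add: connects_def)
    show "W \<subseteq> S \<or> W \<inter> S = {}"
    proof (cases "h \<subseteq> S")
      case True
      then have "S' = insert v S" by (simp add: S'_def)
      then have "W \<subseteq> insert v S" using closed by blast
      then show ?thesis using v by blast
    next
      case False
      then have "S' = S - {v}" by (simp add: S'_def)
      then have "W \<inter> (S - {v}) = {}" using closed by blast
      then show ?thesis using v by blast
    qed
  qed
  moreover have "connects F (insert v W)" if con: "connects (insert h {e \<in> F. v \<notin> e}) W"
    unfolding connects_def
  proof (intro allI impI)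
    fix S assume cl: "\<forall>e\<in>F. e \<subseteq> S \<or> e \<inter> S = {}"
    have hS: "if v \<in> S then h \<subseteq> S else h \<inter> S = {}" using cl unfolding h_def by auto
    then have "\<forall>e\<in>insert h {e \<in> F. v \<notin> e}. e \<subseteq> S \<or> e \<inter> S = {}" using cl by (auto split: if_splits)
    then have "W \<subseteq> S \<or> W \<inter> S = {}" using con unfolding connects_def by blast
    then show "insert v W \<subseteq> S \<or> insert v W \<inter> S = {}"
      using hS hW False by (cases "v \<in> S") (simp_all, blast+)
  qed
  ultimately show ?thesis using False by blast
qed

type_synonym nbr_lists = "(nat \<times> nat list) list"

fun later_nbrs :: "nat list \<Rightarrow> (nat \<times> nat) list \<Rightarrow> nbr_lists" where
  "later_nbrs [] es = []"
| "later_nbrs (v # vs) es =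
    (v, map (\<lambda>(x, y). if x = v then y else x) (filter (\<lambda>(x, y). x = v \<or> y = v) es)) #
    later_nbrs vs (filter (\<lambda>(x, y). x \<noteq> v \<and> y \<noteq> v) es)"

fun joined :: "nat \<Rightarrow> nat list list \<Rightarrow> nat list" where
  "joined v [] = []"
| "joined v (h # H) = (if v \<in> set h then List.union (removeAll v h) (joined v H) else joined v H)"

fun apart :: "nat \<Rightarrow> nat list list \<Rightarrow> nat list list" where
  "apart v [] = []"
| "apart v (h # H) = (if v \<in> set h then apart v H else h # apart v H)"

text \<open>The vertices are eliminated in the given order. The list \<open>U\<close> contains the
  remaining vertices that are already covered by the matching, and \<open>H\<close> contains
  the hyperedges that the eliminated part of the complement of the matching has left on
  the remaining vertices. If the first vertex \<open>v\<close> is not yet covered,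
  \<open>ham_count_match\<close> tries all later neighbours \<open>w\<close> as its partner.
  The new hyperedge \<open>h\<close> joins the remaining later neighbours of \<open>v\<close>
  with the hyperedges at \<open>v\<close>; if it is empty, a component of the complement is
  complete and the branch is cut off unless nothing remains.\<close>

function (sequential) ham_count :: "nbr_lists \<Rightarrow> nat list \<Rightarrow> nat list list \<Rightarrow> nat"
  and ham_count_match :: "nbr_lists \<Rightarrow> nat list \<Rightarrow> nat list \<Rightarrow> nat list \<Rightarrow> nat list \<Rightarrow> nat list list \<Rightarrow> nat"
  and ham_count_close :: "nbr_lists \<Rightarrow> nat list \<Rightarrow> nat list \<Rightarrow> nat list list \<Rightarrow> nat" where
  "ham_count [] U H = 1"
| "ham_count ((v, ws) # A) U H =
    (if v \<in> set U then ham_count_close A (removeAll v U) (List.union ws (joined v H)) (apart v H)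
     else ham_count_match A U [] ws (joined v H) (apart v H))"
| "ham_count_match A U qs [] J R = 0"
| "ham_count_match A U qs (w # ws) J R =
    (if w \<in> set U then 0 else ham_count_close A (w # U) (List.union (qs @ ws) J) R) +
    ham_count_match A U (w # qs) ws J R"
| "ham_count_close A U h R = (if h = [] \<and> A \<noteq> [] then 0 else ham_count A U (h # R))"
  by pat_completeness auto
termination
  by (relation "measures
      [case_sum (\<lambda>(A, _). length A) (case_sum (\<lambda>(A, _). length A) (\<lambda>(A, _). length A)),
       case_sum (\<lambda>_. 0) (case_sum (\<lambda>(A, U, qs, ws, _). 2 + length ws) (\<lambda>_. 1))]") simp_all

lemmas [simp del] = ham_count_close.simps

definition rest_verts :: "nbr_lists \<Rightarrow> nat set" where
  "rest_verts A = fst ` set A"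

definition rest_edges :: "nbr_lists \<Rightarrow> nat set set" where
  "rest_edges A = {{v, w} | v w. \<exists>ws. (v, ws) \<in> set A \<and> w \<in> set ws}"

fun elimination_order :: "nbr_lists \<Rightarrow> bool" where
  "elimination_order [] \<longleftrightarrow> True"
| "elimination_order ((v, ws) # A) \<longleftrightarrow>
    v \<notin> rest_verts A \<and> set ws \<subseteq> rest_verts A \<and> distinct ws \<and> elimination_order A"

text \<open>The sets that \<open>ham_count\<close> counts: extensions of the matching to the remaining
  edges for which the remaining part of the complement together with the hyperedges is
  connected.\<close>

definition completions :: "nbr_lists \<Rightarrow> nat set \<Rightarrow> nat set set \<Rightarrow> nat set set set" where
  "completions A U H = {M. M \<subseteq> rest_edges A \<and>
     (\<forall>x\<in>rest_verts A. if x \<in> U then \<forall>e\<in>M. x \<notin> e else \<exists>!e. e \<in> M \<and> x \<in> e) \<and>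
     connects (H \<union> (rest_edges A - M)) (rest_verts A)}"

lemma rest_Nil [simp]: "rest_verts [] = {}" "rest_edges [] = {}"
  by (auto simp: rest_verts_def rest_edges_def)

lemma rest_Cons [simp]:
  "rest_verts ((v, ws) # A) = insert v (rest_verts A)"
  "rest_edges ((v, ws) # A) = (\<lambda>w. {v, w}) ` set ws \<union> rest_edges A"
  by (auto simp: rest_verts_def rest_edges_def)

lemma rest_edges_subset: "elimination_order A \<Longrightarrow> e \<in> rest_edges A \<Longrightarrow> e \<subseteq> rest_verts A"
  by (induction A rule: elimination_order.induct) auto

lemma finite_rest_edges: "finite (rest_edges A)"
proof (induction A)
  case (Cons x A)
  then show ?case by (cases x) simp
qed simp

lemma finite_completions: "finite (completions A U H)"
  by (rule finite_subset[of _ "Pow (rest_edges A)"]) (auto simp: completions_def finite_rest_edges)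

lemma set_joined: "set (joined v H) = \<Union>{h \<in> set ` set H. v \<in> h} - {v}"
  by (induction H) auto

lemma set_apart: "set ` set (apart v H) = {h \<in> set ` set H. v \<notin> h}"
  by (induction H) auto

text \<open>\<open>T\<close> consists of the later neighbours of \<open>v\<close> along edges of the
  complement.\<close>

lemma connects_first:
  assumes v: "v \<notin> W" and T: "T \<subseteq> W" and H: "\<Union>H \<subseteq> insert v W" and F: "\<Union>F \<subseteq> W"
  defines "h \<equiv> T \<union> (\<Union>{h \<in> H. v \<in> h} - {v})"
  shows "connects (H \<union> ((\<lambda>w. {v, w}) ` T \<union> F)) (insert v W) \<longleftrightarrow>
    (h \<noteq> {} \<or> W = {}) \<and> connects (insert h ({h \<in> H. v \<notin> h} \<union> F)) W"
proof -
  let ?F = "H \<union> ((\<lambda>w. {v, w}) ` T \<union> F)"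
  have "\<Union>?F \<subseteq> insert v W" using T H F by blast
  note * = connects_eliminate[OF v this]
  have "\<Union>{e \<in> ?F. v \<in> e} - {v} = h"
  proof -
    have "v \<notin> T" using v T by blast
    moreover have "v \<notin> e" if "e \<in> F" for e using F v that by blast
    ultimately show ?thesis unfolding h_def by auto
  qed
  moreover have "{e \<in> ?F. v \<notin> e} = {h \<in> H. v \<notin> h} \<union> F" using F v by blast
  ultimately show ?thesis using * by simp
qed

lemma completions_Cons_used:
  assumes A: "elimination_order ((v, ws) # A)" and H: "\<Union>H \<subseteq> insert v (rest_verts A)" and U: "v \<in> U"
  defines "h \<equiv> set ws \<union> (\<Union>{h \<in> H. v \<in> h} - {v})"
  shows "completions ((v, ws) # A) U H =
    (if h = {} \<and> A \<noteq> [] then {} else completions A (U - {v}) (insert h {h \<in> H. v \<notin> h}))"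
proof -
  have v: "v \<notin> rest_verts A" and ws: "set ws \<subseteq> rest_verts A" using A by auto
  have sub: "e \<subseteq> rest_verts A" if "e \<in> rest_edges A" for e using rest_edges_subset A that by auto
  have ne: "rest_verts A = {} \<longleftrightarrow> A = []" by (auto simp: rest_verts_def)
  have "M \<in> completions ((v, ws) # A) U H \<longleftrightarrow>
      (h \<noteq> {} \<or> A = []) \<and> M \<in> completions A (U - {v}) (insert h {h \<in> H. v \<notin> h})" for M
  proof (cases "M \<subseteq> rest_edges A")
    case True
    then have nv: "\<forall>e\<in>M. v \<notin> e" using sub v by blast
    have "(\<lambda>w. {v, w}) ` set ws \<union> rest_edges A - M = (\<lambda>w. {v, w}) ` set ws \<union> (rest_edges A - M)"
      using nv by blast
    moreover have "connects (H \<union> ((\<lambda>w. {v, w}) ` set ws \<union> (rest_edges A - M))) (insert v (rest_verts A)) \<longleftrightarrow>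
      (h \<noteq> {} \<or> A = []) \<and> connects (insert h ({h \<in> H. v \<notin> h} \<union> (rest_edges A - M))) (rest_verts A)"
      unfolding h_def ne[symmetric] by (rule connects_first[OF v ws H]) (use sub in blast)
    moreover have "(\<forall>x\<in>insert v (rest_verts A). if x \<in> U then \<forall>e\<in>M. x \<notin> e else \<exists>!e. e \<in> M \<and> x \<in> e) \<longleftrightarrow>
        (\<forall>x\<in>rest_verts A. if x \<in> U - {v} then \<forall>e\<in>M. x \<notin> e else \<exists>!e. e \<in> M \<and> x \<in> e)"
    proof -
      have "x \<in> U - {v} \<longleftrightarrow> x \<in> U" if "x \<in> rest_verts A" for x using that v by blast
      then show ?thesis using U nv by (simp cong: ball_cong)
    qed
    moreover have "M \<subseteq> (\<lambda>w. {v, w}) ` set ws \<union> rest_edges A" using True by blast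
    ultimately show ?thesis
      unfolding completions_def mem_Collect_eq rest_Cons Un_insert_left using True by (simp add: conj_ac)
  next
    case False
    have "M \<notin> completions ((v, ws) # A) U H"
    proof
      assume "M \<in> completions ((v, ws) # A) U H"
      then have "M \<subseteq> (\<lambda>w. {v, w}) ` set ws \<union> rest_edges A" "\<forall>e\<in>M. v \<notin> e" using U by (auto simp: completions_def)
      then have "M \<subseteq> rest_edges A" by blast
      then show False using False by simp
    qed
    moreover have "M \<notin> completions A (U - {v}) (insert h {h \<in> H. v \<notin> h})" using False by (simp add: completions_def)
    ultimately show ?thesis by blast
  qed
  then show ?thesis by auto
qed

lemma insert_matching_edge:
  assumes A: "elimination_order ((v, ws) # A)" and H: "\<Union>H \<subseteq> insert v (rest_verts A)"
    and U: "v \<notin> U" "w \<notin> U" and w: "w \<in> set ws" and M: "M \<subseteq> rest_edges A"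
  defines "h \<equiv> (set ws - {w}) \<union> (\<Union>{h \<in> H. v \<in> h} - {v})"
  shows "insert {v, w} M \<in> completions ((v, ws) # A) U H \<longleftrightarrow>
    (h \<noteq> {} \<or> A = []) \<and> M \<in> completions A (insert w U) (insert h {h \<in> H. v \<notin> h})"
proof -
  have v: "v \<notin> rest_verts A" and ws: "set ws \<subseteq> rest_verts A" using A by auto
  have sub: "e \<subseteq> rest_verts A" if "e \<in> rest_edges A" for e using rest_edges_subset A that by auto
  have ne: "rest_verts A = {} \<longleftrightarrow> A = []" by (auto simp: rest_verts_def)
  have nv: "v \<notin> e" if "e \<in> rest_edges A" for e using sub v that by blast
  have vw: "v \<noteq> w" using w ws v by blast
  have new: "{v, w} \<notin> M" using nv M by blast
  have "(\<lambda>w. {v, w}) ` set ws \<union> rest_edges A - insert {v, w} M =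
      (\<lambda>w. {v, w}) ` (set ws - {w}) \<union> (rest_edges A - M)"
  proof -
    have "{v, x} = {v, w} \<longleftrightarrow> x = w" for x by (auto simp: doubleton_eq_iff)
    moreover have "{v, x} \<notin> M" "{v, w} \<notin> rest_edges A" for x using nv M by blast+
    ultimately show ?thesis by auto
  qed
  moreover have "connects (H \<union> ((\<lambda>w. {v, w}) ` (set ws - {w}) \<union> (rest_edges A - M))) (insert v (rest_verts A)) \<longleftrightarrow>
      (h \<noteq> {} \<or> A = []) \<and> connects (insert h ({h \<in> H. v \<notin> h} \<union> (rest_edges A - M))) (rest_verts A)"
    unfolding h_def ne[symmetric] by (rule connects_first[OF v _ H]) (use ws sub in blast)+
  moreover have "(if x \<in> U then \<forall>e\<in>insert {v, w} M. x \<notin> e else \<exists>!e. e \<in> insert {v, w} M \<and> x \<in> e) \<longleftrightarrow>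
      (if x \<in> insert w U then \<forall>e\<in>M. x \<notin> e else \<exists>!e. e \<in> M \<and> x \<in> e)" if x: "x \<in> rest_verts A" for x
  proof -
    have xv: "x \<noteq> v" using x v by blast
    show ?thesis
    proof (cases "x = w")
      case True
      have "(\<exists>!e. e \<in> insert {v, w} M \<and> w \<in> e) \<longleftrightarrow> (\<forall>e\<in>M. w \<notin> e)"
        using new by (metis insert_iff)
      then show ?thesis using True U by simp
    next
      case False
      then have "e \<in> insert {v, w} M \<and> x \<in> e \<longleftrightarrow> e \<in> M \<and> x \<in> e" for e using xv by auto
      then have "(\<exists>!e. e \<in> insert {v, w} M \<and> x \<in> e) \<longleftrightarrow> (\<exists>!e. e \<in> M \<and> x \<in> e)" by simp
      then show ?thesis using False xv by simp
    qed
  qed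
  moreover have "\<exists>!e. e \<in> insert {v, w} M \<and> v \<in> e"
    using nv M by (intro ex1I[of _ "{v, w}"]) auto
  moreover have "insert {v, w} M \<subseteq> (\<lambda>w. {v, w}) ` set ws \<union> rest_edges A" using w M by blast
  ultimately show ?thesis using U M by (simp add: completions_def conj_ac cong: ball_cong)
qed

text \<open>The matchings are sorted by the partner \<open>w\<close> of \<open>v\<close>.\<close>

lemma completions_Cons_unused:
  assumes A: "elimination_order ((v, ws) # A)" and H: "\<Union>H \<subseteq> insert v (rest_verts A)" and U: "v \<notin> U"
  defines "h \<equiv> \<lambda>w. (set ws - {w}) \<union> (\<Union>{h \<in> H. v \<in> h} - {v})"
  shows "card (completions ((v, ws) # A) U H) =
    (\<Sum>w\<in>set ws. if w \<in> U \<or> (h w = {} \<and> A \<noteq> []) then 0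
       else card (completions A (insert w U) (insert (h w) {h \<in> H. v \<notin> h})))"
proof -
  let ?C = "\<lambda>w. if w \<in> U \<or> (h w = {} \<and> A \<noteq> []) then {} else completions A (insert w U) (insert (h w) {h \<in> H. v \<notin> h})"
  have v: "v \<notin> rest_verts A" using A by auto
  have nv: "v \<notin> e" if "e \<in> rest_edges A" for e using rest_edges_subset[of A e] A v that by auto
  have C: "M \<subseteq> rest_edges A" if "M \<in> ?C w" for M w using that by (auto simp: completions_def split: if_splits)
  have "completions ((v, ws) # A) U H = (\<Union>w\<in>set ws. insert {v, w} ` ?C w)"
  proof (intro equalityI subsetI)
    fix M assume M: "M \<in> completions ((v, ws) # A) U H"
    then have ex1: "\<exists>!e. e \<in> M \<and> v \<in> e" and sub: "M \<subseteq> (\<lambda>w. {v, w}) ` set ws \<union> rest_edges A"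
      and used: "\<And>x. x \<in> rest_verts A \<Longrightarrow> x \<in> U \<Longrightarrow> \<forall>e\<in>M. x \<notin> e"
      using U by (auto simp: completions_def split: if_splits)
    from ex1 obtain e where e: "e \<in> M" "v \<in> e" "\<forall>f. f \<in> M \<and> v \<in> f \<longrightarrow> f = e"
      by (elim ex1E) blast
    have "e \<in> (\<lambda>w. {v, w}) ` set ws" using e(1,2) sub nv by blast
    then obtain w where w: "w \<in> set ws" "e = {v, w}" by blast
    have "w \<in> rest_verts A" using w A by auto
    then have wU: "w \<notin> U" using used[of w] e(1) w(2) by blast
    have M': "M - {e} \<subseteq> rest_edges A" using sub e(3) by blast
    have M_eq: "insert {v, w} (M - {e}) = M" using e(1) w(2) by blast
    have "(h w \<noteq> {} \<or> A = []) \<and>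
        M - {e} \<in> completions A (insert w U) (insert (h w) {h \<in> H. v \<notin> h})"
      using insert_matching_edge[OF A H U wU w(1) M', unfolded M_eq] M unfolding h_def by (rule iffD1)
    then have "M - {e} \<in> ?C w" using wU by simp
    then have "M \<in> insert {v, w} ` ?C w" by (rule image_eqI[where x = "M - {e}" and f = "insert {v, w}", OF M_eq[symmetric]])
    then show "M \<in> (\<Union>w\<in>set ws. insert {v, w} ` ?C w)" using w(1) by blast
  next
    fix M assume "M \<in> (\<Union>w\<in>set ws. insert {v, w} ` ?C w)"
    then obtain w N where w: "w \<in> set ws" and N: "N \<in> ?C w" "M = insert {v, w} N" by blast
    then have "w \<notin> U" "h w \<noteq> {} \<or> A = []"
      "N \<in> completions A (insert w U) (insert (h w) {h \<in> H. v \<notin> h})" by (auto split: if_splits)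
    note N' = this
    show "M \<in> completions ((v, ws) # A) U H"
      unfolding N(2) insert_matching_edge[OF A H U N'(1) w C[OF N(1)]]
      using N'(2,3) unfolding h_def by (rule conjI)
  qed
  moreover have "card (\<Union>w\<in>set ws. insert {v, w} ` ?C w) = (\<Sum>w\<in>set ws. card (insert {v, w} ` ?C w))"
  proof (rule card_UN_disjoint)
    show "\<forall>w\<in>set ws. finite (insert {v, w} ` ?C w)" using finite_completions by simp
    show "\<forall>w\<in>set ws. \<forall>x\<in>set ws. w \<noteq> x \<longrightarrow> insert {v, w} ` ?C w \<inter> insert {v, x} ` ?C x = {}"
    proof (intro ballI impI, rule ccontr)
      fix w x assume wx: "w \<in> set ws" "x \<in> set ws" "w \<noteq> x"
        and "insert {v, w} ` ?C w \<inter> insert {v, x} ` ?C x \<noteq> {}"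
      then obtain M N where MN: "M \<in> ?C w" "N \<in> ?C x" "insert {v, w} M = insert {v, x} N" by blast
      then have "{v, w} \<in> insert {v, x} N" by blast
      moreover have "{v, w} \<noteq> {v, x}" using wx(3) by (auto simp: doubleton_eq_iff)
      ultimately have "{v, w} \<in> N" by blast
      then show False using C[OF MN(2)] nv by blast
    qed
  qed simp
  moreover have "card (insert {v, w} ` ?C w) = card (?C w)" for w
  proof (rule card_image, rule inj_onI)
    fix M N assume MN: "M \<in> ?C w" "N \<in> ?C w" "insert {v, w} M = insert {v, w} N"
    have "{v, w} \<notin> M" "{v, w} \<notin> N" using C[OF MN(1)] C[OF MN(2)] nv by blast+
    then show "M = N" using MN(3) by (metis insert_ident)
  qed
  ultimately have "card (completions ((v, ws) # A) U H) = (\<Sum>w\<in>set ws. card (?C w))" by simp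
  also have "\<dots> = (\<Sum>w\<in>set ws. if w \<in> U \<or> (h w = {} \<and> A \<noteq> []) then 0
       else card (completions A (insert w U) (insert (h w) {h \<in> H. v \<notin> h})))"
    by (intro sum.cong refl) simp
  finally show ?thesis .
qed

lemma ham_count_correct:
  assumes "elimination_order A" and "\<forall>h\<in>set H. set h \<subseteq> rest_verts A"
  shows "ham_count A U H = card (completions A (set U) (set ` set H))"
  using assms
proof (induction A arbitrary: U H)
  case Nil
  have "completions [] (set U) (set ` set H) = {{}}"
    by (auto simp: completions_def connects_def)
  then show ?case by simp
next
  case (Cons x A)
  obtain v ws where x: "x = (v, ws)" by (cases x)
  have order: "elimination_order ((v, ws) # A)" and H: "\<forall>h\<in>set H. set h \<subseteq> insert v (rest_verts A)"
    using Cons.prems by (auto simp: x)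
  have UH: "\<Union>(set ` set H) \<subseteq> insert v (rest_verts A)" using H by blast
  have ws: "set ws \<subseteq> rest_verts A" and dist: "distinct ws" using order by auto
  let ?J = "joined v H" and ?R = "apart v H"
  have J: "set ?J \<subseteq> rest_verts A" unfolding set_joined using UH by blast
  have R: "\<forall>h\<in>set ?R. set h \<subseteq> rest_verts A"
  proof
    fix h assume "h \<in> set ?R"
    then have "set h \<in> {h \<in> set ` set H. v \<notin> h}" unfolding set_apart[symmetric] by (rule imageI)
    then show "set h \<subseteq> rest_verts A" using UH by blast
  qed
  have close: "ham_count_close A U' h ?R = (if set h = {} \<and> A \<noteq> [] then 0
      else card (completions A (set U') (insert (set h) {h \<in> set ` set H. v \<notin> h})))"
    if "set h \<subseteq> rest_verts A" for U' h
    using Cons.IH[of "h # ?R" U'] order R that by (simp add: set_apart ham_count_close.simps)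
  show ?case
  proof (cases "v \<in> set U")
    case True
    have "set (List.union ws ?J) = set ws \<union> (\<Union>{h \<in> set ` set H. v \<in> h} - {v})"
      by (simp add: set_joined)
    moreover have sub: "set (List.union ws ?J) \<subseteq> rest_verts A" using ws J by simp
    ultimately show ?thesis
      unfolding x ham_count.simps if_P[OF True] completions_Cons_used[OF order UH True] close[OF sub]
      by (simp only: set_removeAll if_distrib[of card] card.empty)
  next
    case False
    let ?g = "\<lambda>w. (set ws - {w}) \<union> set ?J"
    let ?N = "\<lambda>w. if w \<in> set U \<or> (?g w = {} \<and> A \<noteq> []) then 0
       else card (completions A (insert w (set U)) (insert (?g w) {h \<in> set ` set H. v \<notin> h}))"
    have "ham_count_match A U qs zs ?J ?R = (\<Sum>w\<in>set zs. ?N w)"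
      if "distinct (qs @ zs)" "set qs \<union> set zs = set ws" for qs zs
      using that
    proof (induction zs arbitrary: qs)
      case (Cons w zs)
      have "set (List.union (qs @ zs) ?J) = ?g w" using Cons.prems by auto
      moreover have "?g w \<subseteq> rest_verts A" using ws J by blast
      ultimately have "ham_count_close A (w # U) (List.union (qs @ zs) ?J) ?R = (if ?g w = {} \<and> A \<noteq> [] then 0
          else card (completions A (insert w (set U)) (insert (?g w) {h \<in> set ` set H. v \<notin> h})))"
        using close[of "List.union (qs @ zs) ?J" "w # U"] by (simp only: list.set)
      then have "(if w \<in> set U then 0 else ham_count_close A (w # U) (List.union (qs @ zs) ?J) ?R) = ?N w"
        by (cases "w \<in> set U") (simp_all only: if_True if_False simp_thms)
      moreover have "ham_count_match A U (w # qs) zs ?J ?R = (\<Sum>w\<in>set zs. ?N w)"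
        using Cons.prems by (intro Cons.IH) auto
      ultimately show ?case using Cons.prems by simp
    qed simp
    from this[of "[]" ws] dist have match: "ham_count_match A U [] ws ?J ?R = (\<Sum>w\<in>set ws. ?N w)" by simp
    show ?thesis
      unfolding x ham_count.simps if_not_P[OF False] match completions_Cons_unused[OF order UH False] set_joined ..
  qed
qed

lemma later_nbrs_correct:
  assumes "distinct vs" "\<forall>(x, y)\<in>set es. x < y \<and> x \<in> set vs \<and> y \<in> set vs" "distinct es"
  shows "rest_verts (later_nbrs vs es) = set vs \<and> elimination_order (later_nbrs vs es) \<and>
    rest_edges (later_nbrs vs es) = (\<lambda>(x, y). {x, y}) ` set es"
  using assms
proof (induction vs arbitrary: es)
  case (Cons v vs)
  let ?S = "filter (\<lambda>(x, y). x = v \<or> y = v) es" and ?T = "filter (\<lambda>(x, y). x \<noteq> v \<and> y \<noteq> v) es"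
  let ?other = "\<lambda>(x, y). if x = v then y else x"
  have IH: "rest_verts (later_nbrs vs ?T) = set vs" "elimination_order (later_nbrs vs ?T)"
    "rest_edges (later_nbrs vs ?T) = (\<lambda>(x, y). {x, y}) ` set ?T"
    using Cons.IH[of ?T] Cons.prems by auto
  have "inj_on ?other (set ?S)"
  proof (rule inj_onI)
    fix p q assume pq: "p \<in> set ?S" "q \<in> set ?S" "?other p = ?other q"
    obtain x y x' y' where xy: "p = (x, y)" "q = (x', y')" by (cases p; cases q)
    then have "x < y" "x' < y'" using pq Cons.prems(2) by auto
    then show "p = q" using pq xy by (auto split: if_splits)
  qed
  then have dist: "distinct (map ?other ?S)" using Cons.prems(3) by (simp add: distinct_map)
  have later: "set (map ?other ?S) \<subseteq> set vs" using Cons.prems(2) by fastforce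
  have star: "(\<lambda>w. {v, w}) ` set (map ?other ?S) = (\<lambda>(x, y). {x, y}) ` set ?S"
    unfolding set_map image_image by (intro image_cong refl) auto
  have "set es = set ?S \<union> set ?T" by auto
  then have split: "(\<lambda>(x, y). {x, y}) ` set es = (\<lambda>(x, y). {x, y}) ` set ?S \<union> (\<lambda>(x, y). {x, y}) ` set ?T"
    by (simp only: image_Un)
  show ?case
    unfolding later_nbrs.simps rest_Cons elimination_order.simps IH(1,3) star split
    using IH(2) dist later Cons.prems(1) by (intro conjI) simp_all
next
  case Nil
  then have "es = []" by (cases es) auto
  then show ?case by simp
qed

lemma ham_matchings_list_graph:
  assumes "rest_verts A = verts G" "rest_edges A = edges G"
  shows "ham_matchings G = completions A {} {}"
  unfolding ham_matchings_def completions_def perfect_matching_def by (simp add: assms)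

text \<open>In a cubic graph the complement of a perfect matching is 2-regular, so it is a
  hamiltonian cycle as soon as it is connected.\<close>

lemma card_hamiltonian_cycles_list_graph:
  assumes robust: "robust (list_graph n es)" and es: "ordered_pairs n es" "distinct es"
    and vs: "distinct vs" "set vs = {..<n}"
  shows "card (hamiltonian_cycles (list_graph n es)) = ham_count (later_nbrs vs es) [] []"
proof -
  have A: "rest_verts (later_nbrs vs es) = set vs" "elimination_order (later_nbrs vs es)"
    "rest_edges (later_nbrs vs es) = (\<lambda>(x, y). {x, y}) ` set es"
    using later_nbrs_correct[OF vs(1), of es] es vs(2) by (fastforce simp: ordered_pairs_def)+
  then have "ham_matchings (list_graph n es) = completions (later_nbrs vs es) {} {}"
    using vs by (intro ham_matchings_list_graph) (simp_all add: list_graph_def)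
  then show ?thesis
    using card_hamiltonian_cycles[of "list_graph n es"] robust ham_count_correct[OF A(2), of "[]" "[]"]
    by (simp add: robust_def)
qed

section \<open>Integral straight-line drawings\<close>

definition lattice_point :: "(int \<times> int) list \<Rightarrow> nat \<Rightarrow> complex" where
  "lattice_point ps v = Complex (of_int (fst (ps ! v))) (of_int (snd (ps ! v)))"

definition int_orient :: "int \<times> int \<Rightarrow> int \<times> int \<Rightarrow> int \<times> int \<Rightarrow> int" where
  "int_orient a b c = (fst b - fst a) * (snd c - snd a) - (snd b - snd a) * (fst c - fst a)"

lemma orient_lattice_point:
  "orient (lattice_point ps a) (lattice_point ps b) (lattice_point ps c) =
     of_int (int_orient (ps ! a) (ps ! b) (ps ! c))"
  by (simp add: orient_def lattice_point_def int_orient_def)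

type_synonym labelled_segment = "(nat \<times> int \<times> int) \<times> (nat \<times> int \<times> int)"

text \<open>A nested conditional, so that evaluation stops at the first comparison that fails. The
  same holds for the conditionals in \<open>segments_ok\<close> below.\<close>

definition beyond :: "int \<Rightarrow> int \<Rightarrow> int \<Rightarrow> int \<Rightarrow> bool" where
  "beyond a b c d \<longleftrightarrow> (if a < c then if a < d then if b < c then b < d else False else False else False)"

text \<open>Most pairs of segments are separated by a horizontal or vertical line, which is cheaper
  to verify than the signs of determinants.\<close>

fun segments_ok :: "labelled_segment \<Rightarrow> labelled_segment \<Rightarrow> bool" where
  "segments_ok ((a, p), (b, q)) ((c, r), (d, s)) =
    (if beyond (fst p) (fst q) (fst r) (fst s) then True
     else if beyond (fst r) (fst s) (fst p) (fst q) then True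
     else if beyond (snd p) (snd q) (snd r) (snd s) then True
     else if beyond (snd r) (snd s) (snd p) (snd q) then True
     else if a = c then int_orient p q s \<noteq> 0
     else if a = d then int_orient p q r \<noteq> 0
     else if b = c then int_orient q p s \<noteq> 0
     else if b = d then int_orient q p r \<noteq> 0
     else if 0 < int_orient p q r * int_orient p q s then True
     else 0 < int_orient r s p * int_orient r s q)"

fun ok_with_all :: "labelled_segment \<Rightarrow> labelled_segment list \<Rightarrow> bool" where
  "ok_with_all s [] = True"
| "ok_with_all s (t # ts) = (if segments_ok s t then ok_with_all s ts else False)"

fun all_pairs_ok :: "labelled_segment list \<Rightarrow> bool" where
  "all_pairs_ok [] = True"
| "all_pairs_ok (s # ss) = (if ok_with_all s ss then all_pairs_ok ss else False)"

fun labelled :: "(int \<times> int) list \<Rightarrow> (nat \<times> nat) list \<Rightarrow> labelled_segment list" where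
  "labelled ps [] = []"
| "labelled ps ((a, b) # es) = ((a, ps ! a), (b, ps ! b)) # labelled ps es"

lemma cross_free_beyond:
  assumes "beyond (f (ps ! a)) (f (ps ! b)) (f (ps ! c)) (f (ps ! d))" and f: "f = fst \<or> f = snd"
  shows "cross_free (lattice_point ps) {c, d} {a, b}"
proof -
  define w where "w = (if f = fst then 1 else \<i>)"
  have fs: "(fst :: int \<times> int \<Rightarrow> int) \<noteq> snd"
    by (metis fst_conv snd_conv zero_neq_one)
  have w: "w \<bullet> lattice_point ps v = of_int (f (ps ! v))" for v
    using f fs by (auto simp: w_def lattice_point_def inner_complex_def)
  let ?m = "max (f (ps ! a)) (f (ps ! b))"
  have "convex hull {lattice_point ps c, lattice_point ps d} \<inter>
      convex hull {lattice_point ps a, lattice_point ps b} = {}"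
    by (rule disjoint_hulls_of_halfspaces[where w = w and t = "of_int ?m"])
      (use assms(1) in \<open>auto simp: w beyond_def split: if_splits\<close>)
  then show ?thesis by (simp add: cross_free_def)
qed

lemma cross_free_segments:
  assumes "segments_ok ((a, ps ! a), (b, ps ! b)) ((c, ps ! c), (d, ps ! d))"
  shows "cross_free (lattice_point ps) {a, b} {c, d}"
proof -
  let ?o = "\<lambda>x y z. int_orient (ps ! x) (ps ! y) (ps ! z)"
  have adjacent: "cross_free (lattice_point ps) {x, y} {x, z}" if "?o x y z \<noteq> 0" for x y z
    using that by (intro cross_free_adjacent) (simp add: orient_lattice_point)
  have disjoint: "cross_free (lattice_point ps) {w, x} {y, z}" if "0 < ?o w x y * ?o w x z" for w x y z
    using that by (intro cross_free_disjoint) (simp add: orient_lattice_point flip: of_int_mult)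
  note beyond_x = cross_free_beyond[where f = fst, simplified]
    and beyond_y = cross_free_beyond[where f = snd, simplified]
  consider "beyond (fst (ps ! a)) (fst (ps ! b)) (fst (ps ! c)) (fst (ps ! d))"
    | "beyond (fst (ps ! c)) (fst (ps ! d)) (fst (ps ! a)) (fst (ps ! b))"
    | "beyond (snd (ps ! a)) (snd (ps ! b)) (snd (ps ! c)) (snd (ps ! d))"
    | "beyond (snd (ps ! c)) (snd (ps ! d)) (snd (ps ! a)) (snd (ps ! b))"
    | "a = c" "?o a b d \<noteq> 0" | "a = d" "?o a b c \<noteq> 0" | "b = c" "?o b a d \<noteq> 0" | "b = d" "?o b a c \<noteq> 0"
    | "0 < ?o a b c * ?o a b d" | "0 < ?o c d a * ?o c d b"
    using assms by (auto split: if_splits)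
  then show ?thesis
  proof cases
    case 1 then show ?thesis using beyond_x cross_free_sym by metis
  next
    case 2 then show ?thesis by (rule beyond_x)
  next
    case 3 then show ?thesis using beyond_y cross_free_sym by metis
  next
    case 4 then show ?thesis by (rule beyond_y)
  next
    case 5 then show ?thesis using adjacent[of a b d] by simp
  next
    case 6 then show ?thesis using adjacent[of a b c] by (simp add: insert_commute)
  next
    case 7 then show ?thesis using adjacent[of b a d] by (simp add: insert_commute)
  next
    case 8 then show ?thesis using adjacent[of b a c] by (simp add: insert_commute)
  next
    case 9 then show ?thesis by (rule disjoint)
  next
    case 10 then show ?thesis using disjoint[of c d a b] by (simp add: cross_free_sym)
  qed
qed

lemma ok_with_all_iff: "ok_with_all s ts \<longleftrightarrow> (\<forall>t\<in>set ts. segments_ok s t)"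
  by (induction ts) auto

text \<open>The recursive definition serves for evaluation only.\<close>

lemma labelled_eq_map: "labelled ps es = map (\<lambda>(a, b). ((a, ps ! a), (b, ps ! b))) es"
  by (induction ps es rule: labelled.induct) auto

lemma cross_free_pairs:
  assumes "all_pairs_ok (labelled ps es)"
    and "(a, b) \<in> set es" "(c, d) \<in> set es" "(a, b) \<noteq> (c, d)"
  shows "cross_free (lattice_point ps) {a, b} {c, d}"
  using assms
proof (induction es)
  case (Cons e es)
  obtain x y where e: "e = (x, y)" by (cases e)
  have first: "cross_free (lattice_point ps) {x, y} {z, w}" if "(z, w) \<in> set es" for z w
    using Cons.prems(1) that
    by (intro cross_free_segments) (force simp: e ok_with_all_iff labelled_eq_map split: if_splits)
  have rest: "all_pairs_ok (labelled ps es)" using Cons.prems(1) by (simp add: e split: if_splits)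
  show ?case
    using Cons.IH[OF rest] Cons.prems(2-4) first[of a b] first[of c d] by (auto simp: e cross_free_sym)
qed simp

text \<open>A constant of its own, so that evaluating a certificate can stop short of the
  enumeration, for which other rewrite rules are used.\<close>

definition count_hamiltonian :: "nbr_lists \<Rightarrow> nat" where
  "count_hamiltonian A = ham_count A [] []"

text \<open>The lists are the edge insertions \<open>ops\<close> into the cube, the elimination order
  \<open>vs\<close> and the positions \<open>ps\<close> of the vertices in a drawing.\<close>

definition certifies ::
    "(nat \<times> nat \<times> nat \<times> nat) list \<Rightarrow> nat list \<Rightarrow> (int \<times> int) list \<Rightarrow> nat \<Rightarrow> bool" where
  "certifies ops vs ps k \<longleftrightarrow>
    (case grow 8 cube_pairs ops of None \<Rightarrow> False | Some es \<Rightarrow>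
       distinct es \<and> all_pairs_ok (labelled ps es) \<and> count_hamiltonian (later_nbrs vs es) = k) \<and>
    length ps = 8 + 2 * length ops \<and> distinct ps \<and>
    length vs = length ps \<and> distinct vs \<and> (\<forall>v\<in>set vs. v < length ps)"

lemma graph_of_certificate:
  assumes "certifies ops vs ps k"
  shows "\<exists>G :: nat sgraph. simple_graph G \<and> planar G \<and> cyclically_edge_connected 4 G \<and>
    cubic G \<and> card (hamiltonian_cycles G) = k"
proof -
  obtain es where es: "grow 8 cube_pairs ops = Some es" "distinct es"
      "all_pairs_ok (labelled ps es)" "ham_count (later_nbrs vs es) [] [] = k"
    using assms by (auto simp: certifies_def count_hamiltonian_def split: option.splits)
  let ?n = "length ps"
  have n: "?n = 8 + 2 * length ops" and ps: "distinct ps"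
    and vs: "length vs = ?n" "distinct vs" "set vs \<subseteq> {..<?n}"
    using assms by (auto simp: certifies_def)
  have "robust (list_graph ?n es) \<and> ordered_pairs ?n es"
    unfolding n by (rule robust_list_graph_grow[OF robust_cube ordered_pairs_cube es(1)])
  then have robust: "robust (list_graph ?n es)" and ordered: "ordered_pairs ?n es" by auto
  then have simple: "simple_graph (list_graph ?n es)" and cubic: "cubic (list_graph ?n es)"
    and cuts: "four_cuts (list_graph ?n es)"
    by (simp_all add: robust_def)
  have "cyclically_edge_connected 4 (list_graph ?n es)" by (rule cyclically_edge_connectedI[OF simple cuts])
  moreover have "planar (list_graph ?n es)"
  proof (rule planar_straight_line[OF simple cubic])
    show "inj_on (lattice_point ps) (verts (list_graph ?n es))"
    proof (rule inj_onI)
      fix v w assume "v \<in> verts (list_graph ?n es)" "w \<in> verts (list_graph ?n es)"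
        and eq: "lattice_point ps v = lattice_point ps w"
      then have "v < ?n" "w < ?n" by (simp_all add: list_graph_def)
      moreover have "ps ! v = ps ! w" using eq by (simp add: lattice_point_def prod_eq_iff)
      ultimately show "v = w" using ps by (simp add: nth_eq_iff_index_eq)
    qed
    show "cross_free (lattice_point ps) e f"
      if "e \<in> edges (list_graph ?n es)" "f \<in> edges (list_graph ?n es)" "e \<noteq> f" for e f
      using that cross_free_pairs[OF es(3)] by (fastforce simp: list_graph_def)
  qed
  moreover have "set vs = {..<?n}"
    using vs by (intro card_subset_eq) (simp_all add: distinct_card)
  then have "card (hamiltonian_cycles (list_graph ?n es)) = k"
    using card_hamiltonian_cycles_list_graph[OF robust ordered es(2) vs(2)] es(4) by simp
  ultimately show ?thesis using simple cubic by blast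
qed

section \<open>Evaluation of certificates\<close>

text \<open>The following congruence rules keep the simplifier from traversing the lists of vertices
  and segments that are still to be processed. Without them each step would cost time
  proportional to the length of these lists.\<close>

lemma ham_count_cong:
  "U = U' \<Longrightarrow> H = H' \<Longrightarrow> ham_count A U H = ham_count A U' H'"
  by simp

lemma ham_count_match_cong:
  "U = U' \<Longrightarrow> qs = qs' \<Longrightarrow> ws = ws' \<Longrightarrow> J = J' \<Longrightarrow> R = R' \<Longrightarrow>
   ham_count_match A U qs ws J R = ham_count_match A U' qs' ws' J' R'"
  by simp

lemma ham_count_close_cong:
  "U = U' \<Longrightarrow> h = h' \<Longrightarrow> R = R' \<Longrightarrow> ham_count_close A U h R = ham_count_close A U' h' R'"
  by simp

lemma ok_with_all_cong: "s = s' \<Longrightarrow> ok_with_all s ts = ok_with_all s' ts"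
  by simp

lemma close_eval:
  "ham_count_close [] U h R = 1"
  "ham_count_close (a # A) U [] R = 0"
  "ham_count_close (a # A) U (x # h) R = ham_count (a # A) U ((x # h) # R)"
  by (simp_all add: ham_count_close.simps)

lemma member_eval:
  "x \<in> set [] \<longleftrightarrow> False"
  "x \<in> set (y # ys) \<longleftrightarrow> (if x = y then True else x \<in> set ys)"
  by auto

lemma insert_eval: "List.insert x ys = (if x \<in> set ys then ys else x # ys)"
  by (simp add: List.insert_def)

lemma union_eval:
  "List.union [] ys = ys"
  "List.union (x # xs) ys = List.union xs (List.insert x ys)"
  by (simp_all add: List.union_def)

lemmas count_eval = ham_count.simps(1,2) ham_count_match.simps close_eval member_eval insert_eval
  union_eval joined.simps apart.simps removeAll.simps append_Nil append_Cons
  later_nbrs.simps list.map filter.simps prod.case if_True if_False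
  not_True_eq_False not_False_eq_True
  numeral_eq_iff num.distinct num.inject zero_neq_numeral numeral_neq_zero one_eq_numeral_iff numeral_eq_one_iff
  zero_neq_one one_neq_zero simp_thms add_0 add_0_right one_add_one numeral_plus_numeral numeral_plus_one one_plus_numeral
  add_num_simps

section \<open>Two particular graphs\<close>

text \<open>Starting from the faces of the cube, these insertions lead to 2 faces of length 4, 16 of
  length 5, 2 of length 8 and one of length 10.\<close>

definition four_cycles_insertions :: "(nat \<times> nat \<times> nat \<times> nat) list" where
  "four_cycles_insertions = [
     (6, 7, 0, 1), (4, 6, 7, 8), (4, 10, 0, 6), (4, 5, 2, 3), (6, 13, 8, 9), (5, 14, 3, 15),
     (7, 11, 1, 9), (1, 3, 2, 15), (7, 20, 4, 14), (14, 25, 2, 23), (14, 26, 23, 27),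
     (10, 12, 6, 16), (18, 19, 14, 15), (28, 29, 15, 33), (8, 11, 9, 21)]"

definition four_cycles_order :: "nat list" where
  "four_cycles_order = [
     31, 6, 16, 30, 10, 8, 17, 13, 12, 11, 36, 9, 0, 37, 4, 2, 20, 21, 25, 24, 27, 26, 1, 7,
     29, 28, 34, 22, 23, 5, 3, 14, 18, 35, 15, 19, 33, 32]"

definition four_cycles_positions :: "(int \<times> int) list" where
  "four_cycles_positions = [
     (8, -8), (-20, 3), (8, -20), (-16, -7), (9, -31), (-19, -7), (14, 18), (-24, -4), (4, 16),
     (1, 1), (15, 28), (-9, 31), (28, -15), (19, -9), (-13, -13), (-13, -11), (17, 1), (8, 7),
     (-15, -10), (-14, -9), (-28, 15), (-18, 11), (-16, -4), (-12, -10), (-31, -9), (-15, -28),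
     (-8, -23), (-1, -20), (-10, -17), (-7, -15), (31, 9), (21, 10), (-14, -10), (-13, -12),
     (-10, -15), (-12, -12), (-5, 20), (-7, 9)]"

text \<open>Here the faces are one of length 4, 18 of length 5 and 4 of length 8, and Grinberg's
  identity excludes hamiltonian cycles.\<close>

definition non_hamiltonian_insertions :: "(nat \<times> nat \<times> nat \<times> nat) list" where
  "non_hamiltonian_insertions = [
     (0, 1, 6, 7), (0, 8, 6, 9), (4, 5, 7, 9), (0, 2, 1, 8), (1, 7, 9, 13), (10, 11, 8, 9),
     (2, 14, 0, 6), (7, 13, 16, 17), (14, 15, 8, 10), (1, 15, 16, 23), (7, 22, 16, 27),
     (1, 26, 15, 24), (9, 11, 13, 17), (32, 33, 12, 13), (6, 11, 34, 35), (26, 30, 16, 29),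
     (6, 36, 12, 35)]"

definition non_hamiltonian_order :: "nat list" where
  "non_hamiltonian_order = [
     14, 20, 2, 3, 1, 30, 31, 24, 0, 21, 4, 6, 5, 12, 16, 7, 38, 39, 15, 26, 25, 10, 8, 40, 41,
     28, 29, 27, 18, 19, 36, 11, 35, 37, 22, 23, 13, 9, 32, 34, 17, 33]"

definition non_hamiltonian_positions :: "(int \<times> int) list" where
  "non_hamiltonian_positions = [
     (10, 5), (-15, -5), (-5, 15), (-14, 7), (-2, 11), (-10, 6), (2, 10), (-10, 1), (7, -7),
     (3, -2), (10, 1), (4, 1), (-6, 8), (-2, 1), (15, 5), (4, -11), (-11, -3), (0, -2),
     (7, -1), (6, -4), (7, 14), (7, 9), (-4, -1), (-2, -4), (14, -7), (11, -4), (-1, -10),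
     (-3, -7), (-7, -1), (-6, -5), (-7, -14), (5, -15), (3, 0), (0, 0), (1, 1), (-1, 3),
     (2, 4), (1, 3), (-5, -10), (-8, -7), (1, 7), (-3, 7)]"

text \<open>The first step checks the insertions and the drawing, where the vertex 1 has to remain a
  numeral to be comparable with the others; the second step enumerates the matchings.\<close>

lemma four_cycles_certified: "certifies four_cycles_insertions four_cycles_order four_cycles_positions 4"
  by (simp add: certifies_def four_cycles_insertions_def four_cycles_order_def four_cycles_positions_def cube_pairs_def
      beyond_def int_orient_def del: One_nat_def cong: ok_with_all_cong)
    (simp only: count_hamiltonian_def count_eval
      cong: if_weak_cong ham_count_cong ham_count_match_cong ham_count_close_cong)

lemma non_hamiltonian_certified: "certifies non_hamiltonian_insertions non_hamiltonian_order non_hamiltonian_positions 0"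
  by (simp add: certifies_def non_hamiltonian_insertions_def non_hamiltonian_order_def non_hamiltonian_positions_def cube_pairs_def
      beyond_def int_orient_def del: One_nat_def cong: ok_with_all_cong)
    (simp only: count_hamiltonian_def count_eval
      cong: if_weak_cong ham_count_cong ham_count_match_cong ham_count_close_cong)

theorem theorem3p15:
  shows "(\<forall>k::nat. k \<notin> {1, 2, 3} \<longrightarrow>
            (\<exists>G :: nat sgraph. simple_graph G \<and> planar G \<and> cyclically_edge_connected 4 G \<and>
               cubic G \<and> card (hamiltonian_cycles G) = k)) \<and>
         (\<forall>k::nat. k \<in> {1, 2} \<longrightarrow>
            \<not> (\<exists>G :: 'a sgraph. simple_graph G \<and> planar G \<and> cyclically_edge_connected 4 G \<and>
               cubic G \<and> card (hamiltonian_cycles G) = k))"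
proof (intro conjI allI impI)
  fix k :: nat
  assume k: "k \<notin> {1, 2, 3}"
  have prism: "\<exists>G :: nat sgraph. simple_graph G \<and> planar G \<and> cyclically_edge_connected 4 G \<and>
      cubic G \<and> card (hamiltonian_cycles G) = n + (if even n then 2 else 0)" if "4 \<le> n" for n
  proof (intro exI conjI)
    show simple: "simple_graph (prism n)" using that by (intro simple_graph_prism) simp
    show "planar (prism n)" using that by (intro planar_prism) simp
    show "cyclically_edge_connected 4 (prism n)"
      using simple four_cuts_prism[OF that] by (rule cyclically_edge_connectedI)
    show "cubic (prism n)" using that by (intro cubic_prism) simp
    show "card (hamiltonian_cycles (prism n)) = n + (if even n then 2 else 0)"
      using that by (intro card_hamiltonian_cycles_prism) simp
  qed
  consider "k = 0" | "k = 4" | "4 \<le> k" "odd k" | "4 \<le> k - 2" "even k"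
    using k by fastforce
  then show "\<exists>G :: nat sgraph. simple_graph G \<and> planar G \<and> cyclically_edge_connected 4 G \<and>
      cubic G \<and> card (hamiltonian_cycles G) = k"
  proof cases
    case 1
    then show ?thesis using graph_of_certificate[OF non_hamiltonian_certified] by simp
  next
    case 2
    then show ?thesis using graph_of_certificate[OF four_cycles_certified] by simp
  next
    case 3
    then show ?thesis using prism[of k] by simp
  next
    case 4
    then have "even (k - 2)" "k - 2 + 2 = k" by auto
    then show ?thesis using prism[of "k - 2"] 4 by simp
  qed
next
  fix k :: nat
  assume "k \<in> {1, 2}"
  then show "\<not> (\<exists>G :: 'a sgraph. simple_graph G \<and> planar G \<and> cyclically_edge_connected 4 G \<and>
      cubic G \<and> card (hamiltonian_cycles G) = k)"
    using not_one_or_two_hamiltonian_cycles by blast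
qed

end
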